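(* Let $\{\boldsymbol\sigma^k,U_j^k,\mathcal T^k,\mathcal Y^k,\mathcal W^k\}$ be generated by HQ-ADMM (as defined in the context) with $\tau\ge\sqrt{10}$ and $\alpha>0$. Then: 1. The sequence $\{\boldsymbol\sigma^k,U_j^k,\mathcal T^k,\mathcal Y^k,\mathcal W^k\}$ is bounded. 2. The sequence $\{\tilde L_\tau^{k+1,k}\}$ is bounded, nonincreasing and convergent. 3. It holds that $$\sum_{k=1}^{\infty}\Big(\sum_{j=1}^d\|U_j^{k+1}-U_j^k\|_F^2+\|\mathcal T^{k+1}-\mathcal T^k\|_F^2\Big)<+\infty,$$ and, as $k\to\infty$, $$\|\boldsymbol\sigma^{k+1}-\boldsymbol\sigma^k\|\to 0,\qquad \|\mathcal W^{k+1}-\mathcal W^k\|_F\to0,\qquad \|\llbracket\boldsymbol\sigma^k;U_j^k\rrbracket-\mathcal T^k\|_F\to0 .$$ Moreover, every limit point $\{\boldsymbol\sigma^*,U_j^*,\mathcal T^*,\mathcal Y^*,\mathcal W^*\}$ of the sequence satisfies the stationary point system (KKT) given in the context. In particular, $\{\boldsymbol\sigma^*,U_j^*\}$ is also a stationary point (in the sense given in the context) of the problem $$\min_{\boldsymbol\sigma,U_1,\dots,U_d}\ \boldsymbol\Phi_\delta(\mathcal A-\llbracket\boldsymbol\sigma;U_j\rrbracket)\quad\text{s.t. } \|\mathbf u_{j,i}\|=1\ (1\le j\le d-t,\ 1\le i\le R),\quad U_j^\top U_j=I\ (d-t+1\le j\le d).$$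
   Context: **Notation.** $\mathcal A\in\mathbb R^{n_1\times\cdots\times n_d}$ is a given tensor, $R\ge1$ and $1\le t\le d$ are given integers. $\langle\cdot,\cdot\rangle$ and $\|\cdot\|_F$ are the entrywise inner product and Frobenius norm of tensors/matrices, $\circledast$ is the entrywise (Hadamard) product, $\otimes$ the outer product, $\mathcal E$ the all-one tensor, and $\sqrt{\mathcal W}$ is the entrywise square root. Factor matrices are $U_j=[\mathbf u_{j,1},\dots,\mathbf u_{j,R}]\in\mathbb R^{n_j\times R}$, $1\le j\le d$, and for $\boldsymbol\sigma\in\mathbb R^R$, $$\llbracket\boldsymbol\sigma;U_j\rrbracket:=\sum_{i=1}^R\sigma_i\,\mathbf u_{1,i}\otimes\cdots\otimes\mathbf u_{d,i}.$$ The matrices $U_j$, $d-t+1\le j\le d$, are required to satisfy $U_j^\top U_j=I$; for $1\le j\le d-t$ the columns satisfy $\|\mathbf u_{j,i}\|=1$. For a tensor $\mathcal X$ and vectors $\mathbf u_l$, $\mathcal X\bigotimes_{l\ne j}\mathbf u_l\in\mathbb R^{n_j}$ is the gradient of $\langle\mathcal X,\bigotimes_{l=1}^d\mathbf u_l\rangle$ with respect to $\mathbf u_j$. **Cauchy loss.** For $\delta>0$, $\boldsymbol\Phi_\delta(\mathcal X):=\frac{\delta^2}{2}\sum_{i_1,\dots,i_d}\log(1+\mathcal X_{i_1\cdots i_d}^2/\delta^2)$, and $\varrho(\omega):=\omega-\log\omega-1$ with $\log 0=-\infty$. **Augmented Lagrangian.** $$L_\tau(\boldsymbol\sigma,U_j,\mathcal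 T,\mathcal Y,\mathcal W):=\tfrac12\|\sqrt{\mathcal W}\circledast(\mathcal A-\mathcal T)\|_F^2+\tfrac{\delta^2}{2}\sum_{i_1,\dots,i_d}\varrho(\mathcal W_{i_1\cdots i_d})-\langle\mathcal Y,\llbracket\boldsymbol\sigma;U_j\rrbracket-\mathcal T\rangle+\tfrac\tau2\|\llbracket\boldsymbol\sigma;U_j\rrbracket-\mathcal T\|_F^2,$$ $\tilde L_\tau(\boldsymbol\sigma,U_j,\mathcal T,\mathcal Y,\mathcal W,\mathcal T'):=L_\tau(\boldsymbol\sigma,U_j,\mathcal T,\mathcal Y,\mathcal W)+\frac2\tau\|\mathcal T-\mathcal T'\|_F^2$, and $\tilde L_\tau^{k+1,k}:=\tilde L_\tau(\boldsymbol\sigma^{k+1},U_j^{k+1},\mathcal T^{k+1},\mathcal Y^{k+1},\mathcal W^{k+1},\mathcal T^k)$. **HQ-ADMM.** Parameters $\alpha,\tau,\delta>0$. Initialize $U_j^0$ satisfying the constraints above, and $\boldsymbol\sigma^0,\mathcal T^0,\mathcal Y^0$, and $\mathcal W^0\ge0$ (entrywise). For $k=0,1,2,\dots$: (i) For $j=1,\dots,d$ in order, let $\mathbf v_{j,i}^{k+1}:=(\mathcal Y^k+\tau\mathcal T^k)\,\mathbf u_{1,i}^{k+1}\otimes\cdots\otimes\mathbf u_{j-1,i}^{k+1}\otimes\mathbf u_{j+1,i}^k\otimes\cdots\otimes\mathbf u_{d,i}^k\in\mathbb R^{n_j}$ (contraction in all modes except $j$), $\tilde{\mathbf v}_{j,i}^{k+1}:=\sigma_i^k\mathbf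 v_{j,i}^{k+1}+\alpha\mathbf u_{j,i}^k$, $\tilde V_j^{k+1}:=[\tilde{\mathbf v}_{j,1}^{k+1},\dots,\tilde{\mathbf v}_{j,R}^{k+1}]$. If $1\le j\le d-t$: $\mathbf u_{j,i}^{k+1}=\tilde{\mathbf v}_{j,i}^{k+1}/\|\tilde{\mathbf v}_{j,i}^{k+1}\|$, $1\le i\le R$. If $d-t+1\le j\le d$: $U_j^{k+1}\in\arg\max_{U^\top U=I}\langle\tilde V_j^{k+1},U\rangle$, computed as $U_j^{k+1}=PQ^\top$ with $\tilde V_j^{k+1}=P\Xi Q^\top$ an SVD ($P\in\mathbb R^{n_j\times R}$, $\Xi,Q\in\mathbb R^{R\times R}$). (ii) $\mathcal T^{k+1}_{i_1\cdots i_d}=\big(\mathcal W^k_{i_1\cdots i_d}\mathcal A_{i_1\cdots i_d}-\mathcal Y^k_{i_1\cdots i_d}+\tau\llbracket\boldsymbol\sigma^k;U_j^{k+1}\rrbracket_{i_1\cdots i_d}\big)/(\mathcal W^k_{i_1\cdots i_d}+\tau)$. (iii) $\mathcal Y^{k+1}=\mathcal Y^k-\tau(\llbracket\boldsymbol\sigma^k;U_j^{k+1}\rrbracket-\mathcal T^{k+1})$. (iv) $\sigma_i^{k+1}=\langle\mathcal Y^{k+1}+\tau\mathcal T^{k+1},\bigotimes_{j=1}^d\mathbf u_{j,i}^{k+1}\rangle/\tau$, $1\le i\le R$. (v) $\mathcal W^{k+1}_{i_1\cdots i_d}=\delta^2\big(\delta^2+(\mathcal T^{k+1}_{i_1\cdots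 i_d}-\mathcal A_{i_1\cdots i_d})^2\big)^{-1}$. **Stationary point system (KKT).** There exist symmetric $\Lambda_j\in\mathbb R^{R\times R}$, $d-t+1\le j\le d$, such that - $(\mathcal Y+\tau\mathcal T)\bigotimes_{l\ne j}\mathbf u_{l,i}=\sigma_i\tau\,\mathbf u_{j,i}$ and $\mathbf u_{j,i}^\top\mathbf u_{j,i}=1$ for $1\le j\le d-t$, $1\le i\le R$; - $\sigma_i(\mathcal Y+\tau\mathcal T)\bigotimes_{l\ne j}\mathbf u_{l,i}=\sum_{r=1}^R(\Lambda_j)_{i,r}\mathbf u_{j,r}$ for $d-t+1\le j\le d$, $1\le i\le R$, and $U_j^\top U_j=I$ for $d-t+1\le j\le d$; - $(\mathcal W+\tau\mathcal E)\circledast\mathcal T=\mathcal W\circledast\mathcal A-\mathcal Y+\tau\llbracket\boldsymbol\sigma;U_j\rrbracket$; - $\llbracket\boldsymbol\sigma;U_j\rrbracket=\mathcal T$; - $\mathcal W_{i_1\cdots i_d}=\delta^2\big(\delta^2+(\mathcal T_{i_1\cdots i_d}-\mathcal A_{i_1\cdots i_d})^2\big)^{-1}$. **Stationary point of the constrained problem.** A feasible $\{\boldsymbol\sigma,U_j\}$ such that there exist $\eta_{j,i}\in\mathbb R$ and symmetric $\Lambda_j\in\mathbb R^{R\times R}$ with, writing $F(\boldsymbol\sigma,U_1,\dots,U_d)=\boldsymbol\Phi_\delta(\mathcal A-\llbracket\boldsymbol\sigma;U_j\rrbracket)$: $\partial_{\mathbf u_{j,i}}F=\eta_{j,i}\mathbf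 u_{j,i}$ for $1\le j\le d-t$, $1\le i\le R$; $\partial_{\mathbf u_{j,i}}F=\sum_{r=1}^R(\Lambda_j)_{i,r}\mathbf u_{j,r}$ for $d-t+1\le j\le d$, $1\le i\le R$; and $\partial_{\boldsymbol\sigma}F=0$.
   Formalization: At limit points, the first KKT equation (modes 1≤j≤d−t) is asserted only for indices i with σ*_i≠0, since it can fail when σ*_i=0; and the sequence L̃_τ^{k+1,k} is asserted nonincreasing only from k=1 on, since an arbitrary W^0 can make the first step increase. *)

theory Defs
  imports "HOL-Analysis.Analysis"
begin

text \<open>
  The order \<open>d\<close>, the mode sizes \<open>n 1, \<dots>, n d\<close> and the number \<open>R\<close> of rank-one terms are variables,
  so vectors, matrices and tensors are plain functions, of which only the entries inside the index
  ranges below are ever inspected.  All indices start at 1.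

  \<^item> A vector of length \<open>m\<close> is read on \<open>{1..m}\<close>.
  \<^item> Matrices are indexed by column first: \<open>M i p\<close> is the entry in column \<open>i\<close> and row \<open>p\<close>, so
    that \<open>M i\<close> is the \<open>i\<close>-th column.
  \<^item> A family of factor matrices \<open>U\<close> has \<open>U j i p\<close> as the \<open>p\<close>-th entry of the column
    \<open>u\<^sub>j\<^sub>,\<^sub>i\<close> of \<open>U\<^sub>j\<close>.
  \<^item> A tensor is read on the multi-indices \<open>I\<close> in \<open>tidx d n\<close>.
\<close>

type_synonym rvec = "nat \<Rightarrow> real"
type_synonym rmat = "nat \<Rightarrow> rvec"
type_synonym factors = "nat \<Rightarrow> rmat"
type_synonym tensor = "(nat \<Rightarrow> nat) \<Rightarrow> real"

definition tidx :: "nat \<Rightarrow> (nat \<Rightarrow> nat) \<Rightarrow> (nat \<Rightarrow> nat) set" where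
  "tidx d n = (\<Pi>\<^sub>E j\<in>{1..d}. {1..n j})"

definition vnorm :: "nat \<Rightarrow> rvec \<Rightarrow> real" where
  "vnorm m v = L2_set v {1..m}"

definition minner :: "nat \<Rightarrow> nat \<Rightarrow> rmat \<Rightarrow> rmat \<Rightarrow> real" where
  "minner m R V M = (\<Sum>i\<in>{1..R}. \<Sum>p\<in>{1..m}. V i p * M i p)"

definition mnorm :: "nat \<Rightarrow> nat \<Rightarrow> rmat \<Rightarrow> real" where
  "mnorm m R M = sqrt (minner m R M M)"

definition tinner :: "nat \<Rightarrow> (nat \<Rightarrow> nat) \<Rightarrow> tensor \<Rightarrow> tensor \<Rightarrow> real" where
  "tinner d n X Z = (\<Sum>I\<in>tidx d n. X I * Z I)"

definition tnorm :: "nat \<Rightarrow> (nat \<Rightarrow> nat) \<Rightarrow> tensor \<Rightarrow> real" where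
  "tnorm d n X = sqrt (tinner d n X X)"

text \<open>\<open>M\<^sup>T M = I\<close> for an \<open>m \<times> R\<close> matrix.\<close>

definition orthonormal_cols :: "nat \<Rightarrow> nat \<Rightarrow> rmat \<Rightarrow> bool" where
  "orthonormal_cols m R M \<longleftrightarrow>
     (\<forall>i\<in>{1..R}. \<forall>r\<in>{1..R}. (\<Sum>p\<in>{1..m}. M i p * M r p) = (if i = r then 1 else 0))"

definition rank_one :: "nat \<Rightarrow> (nat \<Rightarrow> rvec) \<Rightarrow> tensor" where
  "rank_one d u I = (\<Prod>j\<in>{1..d}. u j (I j))"

definition cp :: "nat \<Rightarrow> nat \<Rightarrow> rvec \<Rightarrow> factors \<Rightarrow> tensor" where
  "cp d R \<sigma> U I = (\<Sum>i\<in>{1..R}. \<sigma> i * rank_one d (\<lambda>j. U j i) I)"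

text \<open>Contraction of \<open>X\<close> with \<open>u l\<close> in all modes \<open>l \<noteq> j\<close>, i.e.\ the gradient of
  \<open>tinner d n X (rank_one d u)\<close> with respect to \<open>u j\<close>; it does not depend on \<open>u j\<close>.\<close>

definition contract :: "nat \<Rightarrow> (nat \<Rightarrow> nat) \<Rightarrow> tensor \<Rightarrow> (nat \<Rightarrow> rvec) \<Rightarrow> nat \<Rightarrow> rvec" where
  "contract d n X u j p =
     (\<Sum>I\<in>{I\<in>tidx d n. I j = p}. X I * (\<Prod>l\<in>{1..d} - {j}. u l (I l)))"

definition feasible :: "nat \<Rightarrow> (nat \<Rightarrow> nat) \<Rightarrow> nat \<Rightarrow> nat \<Rightarrow> factors \<Rightarrow> bool" where
  "feasible d n R t U \<longleftrightarrow>
     (\<forall>j\<in>{1..d - t}. \<forall>i\<in>{1..R}. vnorm (n j) (U j i) = 1) \<and>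
     (\<forall>j\<in>{d - t + 1..d}. orthonormal_cols (n j) R (U j))"

definition cauchy_loss :: "nat \<Rightarrow> (nat \<Rightarrow> nat) \<Rightarrow> real \<Rightarrow> tensor \<Rightarrow> real" where
  "cauchy_loss d n \<delta> X = \<delta>\<^sup>2 / 2 * (\<Sum>I\<in>tidx d n. ln (1 + (X I)\<^sup>2 / \<delta>\<^sup>2))"

text \<open>The convention \<open>log 0 = -\<infinity>\<close> (whereas \<open>ln 0 = 0\<close> here) plays no role below:
  the augmented Lagrangian is only evaluated at weights produced by the update of \<open>W\<close>,
  which are positive.\<close>

definition rho :: "real \<Rightarrow> real" where
  "rho \<omega> = \<omega> - ln \<omega> - 1"

definition aug_lagrangian ::
  "nat \<Rightarrow> (nat \<Rightarrow> nat) \<Rightarrow> nat \<Rightarrow> real \<Rightarrow> real \<Rightarrow> tensor \<Rightarrow>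
   rvec \<Rightarrow> factors \<Rightarrow> tensor \<Rightarrow> tensor \<Rightarrow> tensor \<Rightarrow> real" where
  "aug_lagrangian d n R \<tau> \<delta> A \<sigma> U T Y W =
     1 / 2 * (tnorm d n (\<lambda>I. sqrt (W I) * (A I - T I)))\<^sup>2
     + \<delta>\<^sup>2 / 2 * (\<Sum>I\<in>tidx d n. rho (W I))
     - tinner d n Y (\<lambda>I. cp d R \<sigma> U I - T I)
     + \<tau> / 2 * (tnorm d n (\<lambda>I. cp d R \<sigma> U I - T I))\<^sup>2"

definition aug_lagrangian_prox ::
  "nat \<Rightarrow> (nat \<Rightarrow> nat) \<Rightarrow> nat \<Rightarrow> real \<Rightarrow> real \<Rightarrow> tensor \<Rightarrow>
   rvec \<Rightarrow> factors \<Rightarrow> tensor \<Rightarrow> tensor \<Rightarrow> tensor \<Rightarrow> tensor \<Rightarrow> real" where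
  "aug_lagrangian_prox d n R \<tau> \<delta> A \<sigma> U T Y W T' =
     aug_lagrangian d n R \<tau> \<delta> A \<sigma> U T Y W + 2 / \<tau> * (tnorm d n (\<lambda>I. T I - T' I))\<^sup>2"

text \<open>Column \<open>i\<close> of the matrix used to update mode \<open>j\<close>: modes before \<open>j\<close> already carry the new
  factors \<open>U'\<close>, modes after \<open>j\<close> still carry the old factors \<open>U\<close>.\<close>

definition update_dir ::
  "nat \<Rightarrow> (nat \<Rightarrow> nat) \<Rightarrow> real \<Rightarrow> real \<Rightarrow> rvec \<Rightarrow> tensor \<Rightarrow> tensor \<Rightarrow>
   factors \<Rightarrow> factors \<Rightarrow> nat \<Rightarrow> rmat" where
  "update_dir d n \<alpha> \<tau> \<sigma> T Y U U' j i p =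
     \<sigma> i * contract d n (\<lambda>I. Y I + \<tau> * T I) (\<lambda>l. if l < j then U' l i else U l i) j p
     + \<alpha> * U j i p"

text \<open>The SVD \<open>V = P diag(\<xi>) Q\<^sup>T\<close> of an \<open>m \<times> R\<close> matrix; columns \<open>P r\<close> and \<open>Q r\<close> are the
  left and right singular vectors.\<close>

definition is_svd :: "nat \<Rightarrow> nat \<Rightarrow> rmat \<Rightarrow> rmat \<Rightarrow> rvec \<Rightarrow> rmat \<Rightarrow> bool" where
  "is_svd m R V P \<xi> Q \<longleftrightarrow>
     orthonormal_cols m R P \<and> orthonormal_cols R R Q \<and> (\<forall>r\<in>{1..R}. 0 \<le> \<xi> r) \<and>
     (\<forall>i\<in>{1..R}. \<forall>p\<in>{1..m}. V i p = (\<Sum>r\<in>{1..R}. P r p * \<xi> r * Q r i))"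

text \<open>For the normalised modes a step is only defined if the vector to be normalised is nonzero.\<close>

definition factor_update ::
  "nat \<Rightarrow> (nat \<Rightarrow> nat) \<Rightarrow> nat \<Rightarrow> nat \<Rightarrow> real \<Rightarrow> real \<Rightarrow> rvec \<Rightarrow> tensor \<Rightarrow> tensor \<Rightarrow>
   factors \<Rightarrow> factors \<Rightarrow> bool" where
  "factor_update d n R t \<alpha> \<tau> \<sigma> T Y U U' \<longleftrightarrow>
     (\<forall>j\<in>{1..d - t}. \<forall>i\<in>{1..R}.
        let v = update_dir d n \<alpha> \<tau> \<sigma> T Y U U' j i
        in vnorm (n j) v \<noteq> 0 \<and> (\<forall>p\<in>{1..n j}. U' j i p = v p / vnorm (n j) v)) \<and>
     (\<forall>j\<in>{d - t + 1..d}.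
        let V = update_dir d n \<alpha> \<tau> \<sigma> T Y U U' j
        in is_arg_max (minner (n j) R V) (orthonormal_cols (n j) R) (U' j) \<and>
           (\<exists>P \<xi> Q. is_svd (n j) R V P \<xi> Q \<and>
              (\<forall>i\<in>{1..R}. \<forall>p\<in>{1..n j}. U' j i p = (\<Sum>r\<in>{1..R}. P r p * Q r i))))"

definition hq_admm ::
  "nat \<Rightarrow> (nat \<Rightarrow> nat) \<Rightarrow> nat \<Rightarrow> nat \<Rightarrow> real \<Rightarrow> real \<Rightarrow> real \<Rightarrow> tensor \<Rightarrow>
   (nat \<Rightarrow> rvec) \<Rightarrow> (nat \<Rightarrow> factors) \<Rightarrow> (nat \<Rightarrow> tensor) \<Rightarrow> (nat \<Rightarrow> tensor) \<Rightarrow> (nat \<Rightarrow> tensor) \<Rightarrow> bool"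
where
  "hq_admm d n R t \<alpha> \<tau> \<delta> A \<sigma> U T Y W \<longleftrightarrow>
     feasible d n R t (U 0) \<and>
     (\<forall>I\<in>tidx d n. 0 \<le> W 0 I) \<and>
     (\<forall>k.
        factor_update d n R t \<alpha> \<tau> (\<sigma> k) (T k) (Y k) (U k) (U (Suc k)) \<and>
        (\<forall>I\<in>tidx d n. T (Suc k) I =
           (W k I * A I - Y k I + \<tau> * cp d R (\<sigma> k) (U (Suc k)) I) / (W k I + \<tau>)) \<and>
        (\<forall>I\<in>tidx d n. Y (Suc k) I =
           Y k I - \<tau> * (cp d R (\<sigma> k) (U (Suc k)) I - T (Suc k) I)) \<and>
        (\<forall>i\<in>{1..R}. \<sigma> (Suc k) i =
           tinner d n (\<lambda>I. Y (Suc k) I + \<tau> * T (Suc k) I) (rank_one d (\<lambda>j. U (Suc k) j i)) / \<tau>) \<and>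
        (\<forall>I\<in>tidx d n. W (Suc k) I = \<delta>\<^sup>2 / (\<delta>\<^sup>2 + (T (Suc k) I - A I)\<^sup>2)))"

definition limit_point ::
  "nat \<Rightarrow> (nat \<Rightarrow> nat) \<Rightarrow> nat \<Rightarrow>
   (nat \<Rightarrow> rvec) \<Rightarrow> (nat \<Rightarrow> factors) \<Rightarrow> (nat \<Rightarrow> tensor) \<Rightarrow> (nat \<Rightarrow> tensor) \<Rightarrow> (nat \<Rightarrow> tensor) \<Rightarrow>
   rvec \<Rightarrow> factors \<Rightarrow> tensor \<Rightarrow> tensor \<Rightarrow> tensor \<Rightarrow> bool" where
  "limit_point d n R \<sigma> U T Y W \<sigma>' U' T' Y' W' \<longleftrightarrow>
     (\<exists>s. strict_mono (s :: nat \<Rightarrow> nat) \<and>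
        (\<lambda>k. vnorm R (\<lambda>i. \<sigma> (s k) i - \<sigma>' i)) \<longlonglongrightarrow> 0 \<and>
        (\<forall>j\<in>{1..d}. (\<lambda>k. mnorm (n j) R (\<lambda>i p. U (s k) j i p - U' j i p)) \<longlonglongrightarrow> 0) \<and>
        (\<lambda>k. tnorm d n (\<lambda>I. T (s k) I - T' I)) \<longlonglongrightarrow> 0 \<and>
        (\<lambda>k. tnorm d n (\<lambda>I. Y (s k) I - Y' I)) \<longlonglongrightarrow> 0 \<and>
        (\<lambda>k. tnorm d n (\<lambda>I. W (s k) I - W' I)) \<longlonglongrightarrow> 0)"

text \<open>
  The KKT system.  \<open>J\<close> is the set of components for which the first equation is imposed; the full
  system is the case \<open>J = {1..R}\<close>.  That equation is the stationarity condition in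
  \<open>u\<^sub>j\<^sub>,\<^sub>i\<close> divided by \<open>\<sigma> i\<close>, and it can fail at limit points with \<open>\<sigma> i = 0\<close>:
  for \<open>d = 2\<close>, mode sizes 2 and 1, \<open>R = t = \<delta> = 1\<close>, let \<open>A\<close> be 1 at the multi-index (2,1) and 0
  elsewhere.  Starting from \<open>\<sigma> = 0\<close>, \<open>u\<^sub>1\<^sub>,\<^sub>1 = (1,0)\<close>, \<open>u\<^sub>2\<^sub>,\<^sub>1 = (1)\<close>, \<open>T = 0\<close>,
  \<open>Y = A / 2\<close>, \<open>W = 1 - A / 2\<close>, HQ-ADMM never moves, but the contraction of \<open>Y + \<tau> T\<close> with
  \<open>u\<^sub>2\<^sub>,\<^sub>1\<close> is \<open>(0,1/2) \<noteq> 0\<close>.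
\<close>

definition kkt_system ::
  "nat \<Rightarrow> (nat \<Rightarrow> nat) \<Rightarrow> nat \<Rightarrow> nat \<Rightarrow> nat set \<Rightarrow> real \<Rightarrow> real \<Rightarrow> tensor \<Rightarrow>
   rvec \<Rightarrow> factors \<Rightarrow> tensor \<Rightarrow> tensor \<Rightarrow> tensor \<Rightarrow> bool" where
  "kkt_system d n R t J \<tau> \<delta> A \<sigma> U T Y W \<longleftrightarrow>
     (\<exists>\<Lambda> :: nat \<Rightarrow> nat \<Rightarrow> nat \<Rightarrow> real.
        (\<forall>j\<in>{d - t + 1..d}. \<forall>i\<in>{1..R}. \<forall>r\<in>{1..R}. \<Lambda> j i r = \<Lambda> j r i) \<and>
        (\<forall>j\<in>{1..d - t}. \<forall>i\<in>J. \<forall>p\<in>{1..n j}.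
           contract d n (\<lambda>I. Y I + \<tau> * T I) (\<lambda>l. U l i) j p = \<sigma> i * \<tau> * U j i p) \<and>
        (\<forall>j\<in>{1..d - t}. \<forall>i\<in>{1..R}. (\<Sum>p\<in>{1..n j}. U j i p * U j i p) = 1) \<and>
        (\<forall>j\<in>{d - t + 1..d}. \<forall>i\<in>{1..R}. \<forall>p\<in>{1..n j}.
           \<sigma> i * contract d n (\<lambda>I. Y I + \<tau> * T I) (\<lambda>l. U l i) j p
             = (\<Sum>r\<in>{1..R}. \<Lambda> j i r * U j r p)) \<and>
        (\<forall>j\<in>{d - t + 1..d}. orthonormal_cols (n j) R (U j)) \<and>
        (\<forall>I\<in>tidx d n. (W I + \<tau>) * T I = W I * A I - Y I + \<tau> * cp d R \<sigma> U I) \<and>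
        (\<forall>I\<in>tidx d n. cp d R \<sigma> U I = T I) \<and>
        (\<forall>I\<in>tidx d n. W I = \<delta>\<^sup>2 / (\<delta>\<^sup>2 + (T I - A I)\<^sup>2)))"

definition objective ::
  "nat \<Rightarrow> (nat \<Rightarrow> nat) \<Rightarrow> nat \<Rightarrow> real \<Rightarrow> tensor \<Rightarrow> rvec \<Rightarrow> factors \<Rightarrow> real" where
  "objective d n R \<delta> A \<sigma> U = cauchy_loss d n \<delta> (\<lambda>I. A I - cp d R \<sigma> U I)"

text \<open>The gradient conditions are stated entrywise, through the partial derivatives of the
  (smooth) objective.\<close>

definition stationary_point ::
  "nat \<Rightarrow> (nat \<Rightarrow> nat) \<Rightarrow> nat \<Rightarrow> nat \<Rightarrow> real \<Rightarrow> tensor \<Rightarrow> rvec \<Rightarrow> factors \<Rightarrow> bool" where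
  "stationary_point d n R t \<delta> A \<sigma> U \<longleftrightarrow>
     feasible d n R t U \<and>
     (\<exists>(\<eta> :: nat \<Rightarrow> nat \<Rightarrow> real) (\<Lambda> :: nat \<Rightarrow> nat \<Rightarrow> nat \<Rightarrow> real).
        (\<forall>j\<in>{d - t + 1..d}. \<forall>i\<in>{1..R}. \<forall>r\<in>{1..R}. \<Lambda> j i r = \<Lambda> j r i) \<and>
        (\<forall>j\<in>{1..d - t}. \<forall>i\<in>{1..R}. \<forall>p\<in>{1..n j}.
           ((\<lambda>x. objective d n R \<delta> A \<sigma> (U(j := (U j)(i := (U j i)(p := x)))))
              has_real_derivative \<eta> j i * U j i p) (at (U j i p))) \<and>
        (\<forall>j\<in>{d - t + 1..d}. \<forall>i\<in>{1..R}. \<forall>p\<in>{1..n j}.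
           ((\<lambda>x. objective d n R \<delta> A \<sigma> (U(j := (U j)(i := (U j i)(p := x)))))
              has_real_derivative (\<Sum>r\<in>{1..R}. \<Lambda> j i r * U j r p)) (at (U j i p))) \<and>
        (\<forall>i\<in>{1..R}.
           ((\<lambda>x. objective d n R \<delta> A (\<sigma>(i := x)) U) has_real_derivative 0) (at (\<sigma> i))))"

end

theory Submission
  imports Defs
begin

text \<open>
  The quantity \<open>Lt k = L (k + 1) + 2 / \<tau> \<parallel>T (k + 1) - T k\<parallel>\<^sup>2\<close>, where \<open>L k\<close> is the augmented Lagrangian at
  the \<open>k\<close>-th iterate, is a Lyapunov function: it decreases by at least a constant times the squared
  length of the step.

  For feasible factors the rank-one terms are orthonormal, since inner products of rank-one tensors
  factor over the modes and mode \<open>d\<close> is orthonormal (\<open>tinner_r1_r1\<close>).  Hence \<open>\<parallel>cp \<sigma> U\<parallel>\<^sup>2 = \<parallel>\<sigma>\<parallel>\<^sup>2\<close>, and as a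
  function of the factors \<open>L\<close> is a constant minus \<open>\<langle>Y + \<tau> T, cp \<sigma> U\<rangle>\<close>.  Changing one mode at a time
  telescopes this inner product, each mode update maximises its own term together with a proximal
  term, and the gain is at least \<open>\<alpha> / 2\<close> times the squared step (\<open>factor_update_ascent\<close>).  The
  coefficient update minimises a quadratic exactly, with gain \<open>\<tau> / 2 \<parallel>\<Delta>\<sigma>\<parallel>\<^sup>2\<close>
  (\<open>coefficient_update_descent\<close>).  The updates of \<open>T\<close>, \<open>Y\<close> and \<open>W\<close> act on each entry separately: they
  gain \<open>\<tau> / 2 \<parallel>\<Delta>T\<parallel>\<^sup>2\<close>, lose \<open>\<parallel>\<Delta>Y\<parallel>\<^sup>2 / \<tau>\<close>, and gain something nonnegative (\<open>entry_lagrangian_step\<close>).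

  The loss is controlled through the optimality condition of the \<open>T\<close> update, which reads
  \<open>Y (k + 1) = W k * (A - T (k + 1))\<close>.  As \<open>W k\<close> is the Cauchy weight of \<open>T k - A\<close>, an elementary estimate
  (\<open>cauchy_weight_diff_mult_le\<close>) gives \<open>\<bar>\<Delta>Y\<bar>\<close> at most the sum of the last two \<open>\<bar>\<Delta>T\<bar>\<close> in each entry.
  The proximal term absorbs the older one, and \<open>\<tau>\<^sup>2 \<ge> 10\<close> leaves a positive net rate (\<open>Lprox_descent\<close>).

  The same formula for \<open>Y\<close> bounds \<open>Lt\<close> from below by the Cauchy loss of \<open>T - A\<close> minus a constant
  (\<open>Lprox_lower\<close>).  So \<open>Lt\<close> converges, the squared steps are summable, and, the Cauchy loss being
  coercive, \<open>T\<close> is bounded, with it \<open>Y\<close> and \<open>\<sigma>\<close>.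

  Consecutive iterates then have the same subsequential limits, so all update rules pass to the
  limit.  For an orthonormal mode the update says that the direction matrix \<open>V\<close> and its polar factor
  \<open>M\<close> satisfy \<open>V = M (V\<^sup>T M)\<close> with \<open>V\<^sup>T M\<close> symmetric (\<open>polar_factor\<close>), a closed condition.  For a
  normalised mode one obtains \<open>\<sigma> v = \<tau> \<sigma>\<^sup>2 u\<close> (\<open>unit_mode_limit\<close>), where \<open>v\<close> is the contraction of
  \<open>Y + \<tau> T\<close>; this is what stationarity needs for every component, and dividing by \<open>\<sigma>\<close> where
  \<open>\<sigma> \<noteq> 0\<close> gives the KKT equation.
\<close>

section \<open>Inner products and contractions\<close>

definition vinner :: "nat \<Rightarrow> rvec \<Rightarrow> rvec \<Rightarrow> real" where
  "vinner m u v = (\<Sum>p\<in>{1..m}. u p * v p)"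

lemma vinner_commute: "vinner m u v = vinner m v u"
  by (simp add: vinner_def mult.commute)

lemma vinner_diff_right: "vinner m u (\<lambda>p. v p - w p) = vinner m u v - vinner m u w"
  by (simp add: vinner_def right_diff_distrib sum_subtractf)

lemma vinner_cong:
  "(\<And>p. p \<in> {1..m} \<Longrightarrow> u p = u' p) \<Longrightarrow> (\<And>p. p \<in> {1..m} \<Longrightarrow> v p = v' p) \<Longrightarrow>
     vinner m u v = vinner m u' v'"
  unfolding vinner_def by (rule sum.cong) simp_all

lemma minner_vinner: "minner m R V M = (\<Sum>i\<in>{1..R}. vinner m (V i) (M i))"
  by (simp add: minner_def vinner_def)

lemma orthonormal_cols_vinner:
  "orthonormal_cols m R M \<longleftrightarrow>
     (\<forall>i\<in>{1..R}. \<forall>r\<in>{1..R}. vinner m (M i) (M r) = (if i = r then 1 else 0))"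
  by (simp add: orthonormal_cols_def vinner_def)

lemma vnorm_power2: "(vnorm m v)\<^sup>2 = vinner m v v"
  by (simp add: vnorm_def L2_set_def vinner_def sum_nonneg power2_eq_square)

lemma vnorm_eq_sqrt: "vnorm m v = sqrt (vinner m v v)"
  by (simp add: vnorm_def L2_set_def vinner_def power2_eq_square)

lemma vinner_le_vnorm: "vinner m u v \<le> vnorm m u * vnorm m v"
proof -
  have "vinner m u v \<le> (\<Sum>p\<in>{1..m}. \<bar>u p\<bar> * \<bar>v p\<bar>)"
    unfolding vinner_def by (intro sum_mono) (metis abs_ge_self abs_mult)
  also have "\<dots> \<le> vnorm m u * vnorm m v"
    unfolding vnorm_def by (rule L2_set_mult_ineq)
  finally show ?thesis .
qed

lemma vnorm_normalised:
  assumes "vnorm m v \<noteq> 0" and "\<And>p. p \<in> {1..m} \<Longrightarrow> u p = v p / vnorm m v"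
  shows "vnorm m u = 1" and "vinner m v u = vnorm m v"
proof -
  have "vinner m u u = vinner m v v / (vnorm m v)\<^sup>2"
    using assms(2) by (simp add: vinner_def power2_eq_square sum_divide_distrib)
  also have "\<dots> = 1"
    using assms(1) by (simp flip: vnorm_power2)
  finally show "vnorm m u = 1"
    by (simp add: vnorm_eq_sqrt)
  have "vinner m v u = vinner m v v / vnorm m v"
    using assms(2) by (simp add: vinner_def sum_divide_distrib)
  also have "\<dots> = vnorm m v"
    using assms(1) by (simp flip: vnorm_power2 add: power2_eq_square)
  finally show "vinner m v u = vnorm m v" .
qed

lemma finite_tidx [simp]: "finite (tidx d n)"
  by (auto simp: tidx_def intro: finite_PiE)

lemma tidx_in: "I \<in> tidx d n \<Longrightarrow> j \<in> {1..d} \<Longrightarrow> I j \<in> {1..n j}"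
  unfolding tidx_def by (rule PiE_mem)

lemma tinner_commute: "tinner d n X Z = tinner d n Z X"
  by (simp add: tinner_def mult.commute)

lemma tinner_cong:
  "(\<And>I. I \<in> tidx d n \<Longrightarrow> X I = X' I) \<Longrightarrow> (\<And>I. I \<in> tidx d n \<Longrightarrow> Z I = Z' I) \<Longrightarrow>
     tinner d n X Z = tinner d n X' Z'"
  unfolding tinner_def by (rule sum.cong) simp_all

lemma tinner_diff_right: "tinner d n X (\<lambda>I. Z I - Z' I) = tinner d n X Z - tinner d n X Z'"
  by (simp add: tinner_def right_diff_distrib sum_subtractf)

lemma tinner_add_left:
  "tinner d n (\<lambda>I. X I + c * X' I) Z = tinner d n X Z + c * tinner d n X' Z"
  by (simp add: tinner_def distrib_right sum.distrib sum_distrib_left mult.assoc)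

lemma tinner_cp:
  "tinner d n X (cp d R \<sigma> U) = (\<Sum>i\<in>{1..R}. \<sigma> i * tinner d n X (rank_one d (\<lambda>j. U j i)))"
proof -
  have "tinner d n X (cp d R \<sigma> U)
      = (\<Sum>I\<in>tidx d n. \<Sum>i\<in>{1..R}. \<sigma> i * (X I * rank_one d (\<lambda>j. U j i) I))"
    by (simp add: tinner_def cp_def sum_distrib_left mult_ac)
  also have "\<dots> = (\<Sum>i\<in>{1..R}. \<Sum>I\<in>tidx d n. \<sigma> i * (X I * rank_one d (\<lambda>j. U j i) I))"
    by (rule sum.swap)
  finally show ?thesis
    by (simp add: tinner_def sum_distrib_left)
qed

lemma contract_cong:
  assumes "\<And>l. l \<in> {1..d} - {j} \<Longrightarrow> u l = u' l"
  shows "contract d n X u j = contract d n X u' j"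
proof
  fix p
  have "(\<Prod>l\<in>{1..d} - {j}. u l (I l)) = (\<Prod>l\<in>{1..d} - {j}. u' l (I l))" for I
    by (rule prod.cong) (simp_all add: assms)
  then show "contract d n X u j p = contract d n X u' j p"
    by (simp add: contract_def)
qed

lemma contract_add:
  "contract d n (\<lambda>I. X I + c * X' I) u j p = contract d n X u j p + c * contract d n X' u j p"
  by (simp add: contract_def distrib_right sum.distrib sum_distrib_left mult.assoc)

lemma rank_one_split:
  "j \<in> {1..d} \<Longrightarrow> rank_one d u I = u j (I j) * (\<Prod>l\<in>{1..d} - {j}. u l (I l))"
  by (simp add: rank_one_def prod.remove)

text \<open>A rank-one tensor is linear in each of its factors, and the contraction is the coefficient
  vector of that linear dependence.\<close>

lemma tinner_rank_one_contract:
  assumes j: "j \<in> {1..d}"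
  shows "tinner d n X (rank_one d u) = vinner (n j) (contract d n X u j) (u j)"
proof -
  have "vinner (n j) (contract d n X u j) (u j)
      = (\<Sum>p\<in>{1..n j}. \<Sum>I\<in>{I\<in>tidx d n. I j = p}. X I * rank_one d u I)"
    unfolding vinner_def contract_def sum_distrib_right
    by (intro sum.cong refl) (simp add: rank_one_split[OF j])
  also have "\<dots> = (\<Sum>I\<in>tidx d n. X I * rank_one d u I)"
    by (rule sum.group) (use tidx_in j in auto)
  finally show ?thesis
    by (simp add: tinner_def)
qed

lemma tinner_rank_one_rank_one:
  "tinner d n (rank_one d u) (rank_one d v) = (\<Prod>j\<in>{1..d}. vinner (n j) (u j) (v j))"
proof -
  have "(\<Prod>j\<in>{1..d}. vinner (n j) (u j) (v j))
      = (\<Sum>I\<in>tidx d n. \<Prod>j\<in>{1..d}. u j (I j) * v j (I j))"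
    unfolding vinner_def tidx_def by (rule prod_sum_PiE) auto
  then show ?thesis
    by (simp add: tinner_def rank_one_def prod.distrib)
qed

lemma contract_rank_one:
  assumes j: "j \<in> {1..d}" and p: "p \<in> {1..n j}"
  shows "contract d n (rank_one d v) u j p
           = v j p * (\<Prod>l\<in>{1..d} - {j}. vinner (n l) (v l) (u l))"
proof -
  \<comment> \<open>testing both sides against the unit vector \<open>e\<close> in mode \<open>j\<close> reads off their entry \<open>p\<close>\<close>
  define e :: rvec where "e q = (if q = p then 1 else 0)" for q
  have e: "vinner (n j) w e = w p" for w
    using p by (simp add: vinner_def e_def if_distrib cong: if_cong)
  have "contract d n (rank_one d v) u j p
      = vinner (n j) (contract d n (rank_one d v) (u(j := e)) j) ((u(j := e)) j)"
    using contract_cong[of d j u "u(j := e)" n "rank_one d v"] by (simp add: e)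
  also have "\<dots> = (\<Prod>l\<in>{1..d}. vinner (n l) (v l) ((u(j := e)) l))"
    by (simp only: tinner_rank_one_contract[OF j, symmetric] tinner_rank_one_rank_one)
  also have "\<dots> = vinner (n j) (v j) e * (\<Prod>l\<in>{1..d} - {j}. vinner (n l) (v l) (u l))"
    using j by (simp add: prod.remove)
  finally show ?thesis
    by (simp add: e)
qed

lemma contract_cp:
  assumes j: "j \<in> {1..d}" and p: "p \<in> {1..n j}"
  shows "contract d n (cp d R \<sigma> U) u j p
           = (\<Sum>i\<in>{1..R}. \<sigma> i * (U j i p * (\<Prod>l\<in>{1..d} - {j}. vinner (n l) (U l i) (u l))))"
proof -
  have "contract d n (cp d R \<sigma> U) u j p
      = (\<Sum>i\<in>{1..R}. \<sigma> i * contract d n (rank_one d (\<lambda>j. U j i)) u j p)"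
    unfolding contract_def cp_def sum_distrib_right sum_distrib_left
    by (subst sum.swap) (simp add: mult_ac)
  then show ?thesis
    using contract_rank_one[of j d p n] j p by simp
qed

section \<open>Feasible factors\<close>

locale cp_problem =
  fixes d R t :: nat and n :: "nat \<Rightarrow> nat"
  assumes t_ge_1: "1 \<le> t" and t_le_d: "t \<le> d"
begin

abbreviation "r1 U i \<equiv> rank_one d (\<lambda>j. U j i)" for U :: factors

lemma last_mode: "d \<in> {d - t + 1..d}" "d \<in> {1..d}" "d \<notin> {1..d - t}"
  using t_ge_1 t_le_d by auto

lemma modes_cases:
  assumes "j \<in> {1..d}"
  obtains "j \<in> {1..d - t}" | "j \<in> {d - t + 1..d}"
  using assms by fastforce

lemma modes_in: "j \<in> {1..d - t} \<Longrightarrow> j \<in> {1..d}" "j \<in> {d - t + 1..d} \<Longrightarrow> j \<in> {1..d}"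
  by auto

lemma feasible_unit:
  assumes "feasible d n R t U" "j \<in> {1..d}" "i \<in> {1..R}"
  shows "vinner (n j) (U j i) (U j i) = 1"
  using assms(2)
proof (cases rule: modes_cases)
  case 1
  then show ?thesis
    using assms by (simp add: feasible_def flip: vnorm_power2)
next
  case 2
  then show ?thesis
    using assms by (simp add: feasible_def orthonormal_cols_vinner)
qed

lemma feasible_vnorm:
  assumes "feasible d n R t U" "j \<in> {1..d}" "i \<in> {1..R}"
  shows "vnorm (n j) (U j i) = 1"
  by (simp add: vnorm_eq_sqrt feasible_unit[OF assms])

lemma feasible_orthogonal:
  assumes "feasible d n R t U" "j \<in> {d - t + 1..d}" "i \<in> {1..R}" "r \<in> {1..R}"
  shows "vinner (n j) (U j i) (U j r) = (if i = r then 1 else 0)"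
  using assms by (simp add: feasible_def orthonormal_cols_vinner)

text \<open>The inner product of two rank-one tensors factors over the modes.  Mode \<open>d\<close> has orthonormal
  columns because \<open>1 \<le> t\<close>, and its factor annihilates every product with \<open>i \<noteq> r\<close>.  The set \<open>L\<close> is all
  modes when whole rank-one tensors are paired, and all modes but \<open>j\<close> for contractions in mode \<open>j\<close>.\<close>

lemma prod_vinner_feasible:
  assumes U: "feasible d n R t U" and L: "L \<subseteq> {1..d}" "d \<in> L" and i: "i \<in> {1..R}" and r: "r \<in> {1..R}"
  shows "(\<Prod>l\<in>L. vinner (n l) (U l i) (U l r)) = (if i = r then 1 else 0)"
proof (cases "i = r")
  case True
  then show ?thesis
    using L by (auto intro!: prod.neutral feasible_unit[OF U] i r)
next
  case False
  have "finite L"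
    using L(1) finite_subset by blast
  moreover have "vinner (n d) (U d i) (U d r) = 0"
    using feasible_orthogonal[OF U last_mode(1) i r] False by simp
  ultimately show ?thesis
    using False L(2) by (auto intro: prod_zero)
qed

lemma tinner_r1_r1:
  assumes "feasible d n R t U" "i \<in> {1..R}" "r \<in> {1..R}"
  shows "tinner d n (r1 U i) (r1 U r) = (if i = r then 1 else 0)"
  using prod_vinner_feasible[OF assms(1) subset_refl last_mode(2) assms(2,3)]
  by (simp add: tinner_rank_one_rank_one)

lemma tinner_cp_r1:
  assumes "feasible d n R t U" "i \<in> {1..R}"
  shows "tinner d n (cp d R \<sigma> U) (r1 U i) = \<sigma> i"
proof -
  have "tinner d n (r1 U i) (cp d R \<sigma> U) = (\<Sum>r\<in>{1..R}. \<sigma> r * (if i = r then 1 else 0))"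
    unfolding tinner_cp by (rule sum.cong[OF refl]) (simp only: tinner_r1_r1[OF assms])
  also have "\<dots> = \<sigma> i"
    using assms(2) by (simp add: if_distrib cong: if_cong)
  finally show ?thesis
    by (simp add: tinner_commute)
qed

lemma tinner_cp_cp:
  assumes "feasible d n R t U"
  shows "tinner d n (cp d R \<sigma> U) (cp d R \<sigma> U) = (\<Sum>i\<in>{1..R}. (\<sigma> i)\<^sup>2)"
  unfolding tinner_cp
  by (rule sum.cong) (simp_all add: tinner_cp_r1 assms power2_eq_square)

lemma feasible_entry_le_1:
  assumes "feasible d n R t U" "j \<in> {1..d}" "i \<in> {1..R}" "p \<in> {1..n j}"
  shows "\<bar>U j i p\<bar> \<le> 1"
proof -
  have "(U j i p)\<^sup>2 \<le> (\<Sum>q\<in>{1..n j}. (U j i q)\<^sup>2)"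
    using assms(4) by (intro member_le_sum) auto
  also have "\<dots> = 1"
    using feasible_unit[OF assms(1-3)] by (simp add: vinner_def power2_eq_square)
  finally show ?thesis
    by (simp add: abs_square_le_1)
qed

lemma r1_entry_le_1:
  assumes "feasible d n R t U" "i \<in> {1..R}" "I \<in> tidx d n"
  shows "\<bar>r1 U i I\<bar> \<le> 1"
  unfolding rank_one_def abs_prod
  by (rule prod_le_1) (use feasible_entry_le_1 assms tidx_in in auto)

end

section \<open>The Cauchy weight\<close>

definition cauchy_weight :: "real \<Rightarrow> real \<Rightarrow> real" where
  "cauchy_weight \<delta> x = \<delta>\<^sup>2 / (\<delta>\<^sup>2 + x\<^sup>2)"

lemma cauchy_weight_pos: "\<delta> > 0 \<Longrightarrow> cauchy_weight \<delta> x > 0"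
  by (simp add: cauchy_weight_def add_pos_nonneg)

lemma cauchy_weight_le_1: "\<delta> > 0 \<Longrightarrow> cauchy_weight \<delta> x \<le> 1"
  by (simp add: cauchy_weight_def divide_le_eq add_pos_nonneg)

lemma cauchy_weight_mult_le:
  assumes "\<delta> > 0"
  shows "\<bar>cauchy_weight \<delta> x * x\<bar> \<le> \<delta> / 2"
proof -
  have "2 * (\<delta> * \<bar>x\<bar>) \<le> \<delta>\<^sup>2 + x\<^sup>2"
    using sum_squares_bound[of \<delta> "\<bar>x\<bar>"] by (simp add: mult.assoc)
  then have "2 * (\<delta>\<^sup>2 * \<bar>x\<bar>) \<le> \<delta> * (\<delta>\<^sup>2 + x\<^sup>2)"
    using mult_left_mono[of _ _ \<delta>] assms by (simp add: power2_eq_square mult_ac)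
  then show ?thesis
    using assms by (simp add: cauchy_weight_def abs_mult field_simps add_pos_nonneg)
qed

lemma cauchy_weight_diff:
  assumes "\<delta> > 0"
  shows "cauchy_weight \<delta> x - cauchy_weight \<delta> y
    = (y - x) * (\<delta>\<^sup>2 * (x + y) / ((\<delta>\<^sup>2 + x\<^sup>2) * (\<delta>\<^sup>2 + y\<^sup>2)))"
proof -
  have "\<delta>\<^sup>2 + x\<^sup>2 > 0" "\<delta>\<^sup>2 + y\<^sup>2 > 0"
    using assms by (simp_all add: add_pos_nonneg)
  then have nz: "\<delta>\<^sup>2 + x\<^sup>2 \<noteq> 0" "\<delta>\<^sup>2 + y\<^sup>2 \<noteq> 0"
    by auto
  have "c / a - c / b = c * (b - a) / (a * b)" if "a \<noteq> 0" "b \<noteq> 0" for a b c :: real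
    using that by (simp add: field_simps)
  from this[OF nz] have "cauchy_weight \<delta> x - cauchy_weight \<delta> y
      = \<delta>\<^sup>2 * ((\<delta>\<^sup>2 + y\<^sup>2) - (\<delta>\<^sup>2 + x\<^sup>2)) / ((\<delta>\<^sup>2 + x\<^sup>2) * (\<delta>\<^sup>2 + y\<^sup>2))"
    unfolding cauchy_weight_def .
  also have "(\<delta>\<^sup>2 + y\<^sup>2) - (\<delta>\<^sup>2 + x\<^sup>2) = (y - x) * (x + y)"
    by (simp add: power2_eq_square algebra_simps)
  finally show ?thesis
    by (simp add: mult_ac)
qed

lemma cauchy_weight_lipschitz:
  assumes \<delta>: "\<delta> > 0"
  shows "\<bar>cauchy_weight \<delta> x - cauchy_weight \<delta> y\<bar> \<le> \<bar>x - y\<bar> / \<delta>"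
proof -
  let ?D = "(\<delta>\<^sup>2 + x\<^sup>2) * (\<delta>\<^sup>2 + y\<^sup>2)"
  have D: "?D > 0"
    using \<delta> by (simp add: add_pos_nonneg)
  have b: "2 * (\<delta> * \<bar>z\<bar>) \<le> \<delta>\<^sup>2 + z\<^sup>2" for z
    using sum_squares_bound[of \<delta> "\<bar>z\<bar>"] by (simp add: mult.assoc)
  have "2 * (\<delta> * \<bar>x\<bar>) * \<delta>\<^sup>2 \<le> (\<delta>\<^sup>2 + x\<^sup>2) * (\<delta>\<^sup>2 + y\<^sup>2)"
    using b[of x] by (intro mult_mono) auto
  moreover have "2 * (\<delta> * \<bar>y\<bar>) * \<delta>\<^sup>2 \<le> (\<delta>\<^sup>2 + y\<^sup>2) * (\<delta>\<^sup>2 + x\<^sup>2)"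
    using b[of y] by (intro mult_mono) auto
  ultimately have "\<delta> * (\<delta>\<^sup>2 * (\<bar>x\<bar> + \<bar>y\<bar>)) \<le> ?D"
    by (simp add: algebra_simps)
  moreover have "\<delta> * (\<delta>\<^sup>2 * \<bar>x + y\<bar>) \<le> \<delta> * (\<delta>\<^sup>2 * (\<bar>x\<bar> + \<bar>y\<bar>))"
    using \<delta> by (intro mult_left_mono abs_triangle_ineq) auto
  ultimately have "\<delta> * \<bar>\<delta>\<^sup>2 * (x + y)\<bar> \<le> ?D"
    by (simp add: abs_mult)
  then have "\<bar>\<delta>\<^sup>2 * (x + y) / ?D\<bar> \<le> 1 / \<delta>"
    using D \<delta> by (simp only: abs_divide abs_of_pos[OF D]) (simp add: field_simps)
  from mult_left_mono[OF this, of "\<bar>y - x\<bar>"] show ?thesis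
    unfolding cauchy_weight_diff[OF \<delta>] abs_mult by (simp add: abs_minus_commute)
qed

text \<open>Sharper than a Lipschitz bound: the weight decays fast enough to absorb the factor \<open>x\<close>.
  This makes the dual step no longer than two successive steps in the tensor, whatever the size of
  the residual.\<close>

lemma cauchy_weight_diff_mult_le:
  assumes \<delta>: "\<delta> > 0"
  shows "\<bar>(cauchy_weight \<delta> x - cauchy_weight \<delta> y) * x\<bar> \<le> \<bar>x - y\<bar>"
proof -
  let ?D = "(\<delta>\<^sup>2 + x\<^sup>2) * (\<delta>\<^sup>2 + y\<^sup>2)"
  have D: "?D > 0"
    using \<delta> by (simp add: add_pos_nonneg)
  have "2 * (\<delta>\<^sup>2 * \<bar>x * y\<bar>) \<le> (\<delta>\<^sup>2)\<^sup>2 + (x * y)\<^sup>2"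
    using sum_squares_bound[of "\<delta>\<^sup>2" "\<bar>x * y\<bar>"] by (simp add: mult.assoc)
  moreover have "\<bar>(x + y) * x\<bar> \<le> x\<^sup>2 + \<bar>x * y\<bar>"
    using abs_triangle_ineq[of "x * x" "y * x"]
    by (simp add: power2_eq_square algebra_simps)
  then have "\<delta>\<^sup>2 * \<bar>(x + y) * x\<bar> \<le> \<delta>\<^sup>2 * (x\<^sup>2 + \<bar>x * y\<bar>)"
    by (intro mult_left_mono) auto
  then have "\<delta>\<^sup>2 * \<bar>(x + y) * x\<bar> \<le> \<delta>\<^sup>2 * x\<^sup>2 + \<delta>\<^sup>2 * \<bar>x * y\<bar>"
    by (simp only: distrib_left)
  moreover have "0 \<le> \<delta>\<^sup>2 * y\<^sup>2" "0 \<le> \<delta>\<^sup>2 * \<bar>x * y\<bar>"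
    by auto
  moreover have "?D = (\<delta>\<^sup>2)\<^sup>2 + \<delta>\<^sup>2 * x\<^sup>2 + \<delta>\<^sup>2 * y\<^sup>2 + (x * y)\<^sup>2"
    by (simp add: power2_eq_square algebra_simps)
  ultimately have "\<delta>\<^sup>2 * \<bar>(x + y) * x\<bar> \<le> ?D"
    by linarith
  moreover have "\<bar>\<delta>\<^sup>2 * (x + y) / ?D * x\<bar> = \<delta>\<^sup>2 * \<bar>(x + y) * x\<bar> / ?D"
    by (simp add: abs_mult)
  ultimately have "\<bar>\<delta>\<^sup>2 * (x + y) / ?D * x\<bar> \<le> 1"
    using D by (simp only: divide_le_eq_1_pos)
  from mult_left_mono[OF this, of "\<bar>y - x\<bar>"] show ?thesis
    unfolding cauchy_weight_diff[OF \<delta>] by (simp add: abs_mult abs_minus_commute mult.assoc)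
qed

section \<open>The augmented Lagrangian, entry by entry\<close>

definition entry_lagrangian ::
  "real \<Rightarrow> real \<Rightarrow> real \<Rightarrow> real \<Rightarrow> real \<Rightarrow> real \<Rightarrow> real \<Rightarrow> real" where
  "entry_lagrangian \<tau> \<delta> a s t y w =
     w / 2 * (a - t)\<^sup>2 + \<delta>\<^sup>2 / 2 * rho w - y * (s - t) + \<tau> / 2 * (s - t)\<^sup>2"

lemma tnorm_power2: "(tnorm d n X)\<^sup>2 = (\<Sum>I\<in>tidx d n. (X I)\<^sup>2)"
  by (simp add: tnorm_def tinner_def sum_nonneg power2_eq_square)

lemma mnorm_power2: "(mnorm m R M)\<^sup>2 = (\<Sum>i\<in>{1..R}. vinner m (M i) (M i))"
  by (simp add: mnorm_def minner_vinner sum_nonneg vinner_def)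

lemma aug_lagrangian_entries:
  assumes "\<And>I. I \<in> tidx d n \<Longrightarrow> 0 \<le> W I"
  shows "aug_lagrangian d n R \<tau> \<delta> A \<sigma> U T Y W
    = (\<Sum>I\<in>tidx d n. entry_lagrangian \<tau> \<delta> (A I) (cp d R \<sigma> U I) (T I) (Y I) (W I))"
proof -
  have "(\<Sum>I\<in>tidx d n. (sqrt (W I) * (A I - T I))\<^sup>2) = (\<Sum>I\<in>tidx d n. W I * (A I - T I)\<^sup>2)"
    using assms by (intro sum.cong) (auto simp: power_mult_distrib)
  then show ?thesis
    by (simp add: aug_lagrangian_def entry_lagrangian_def tnorm_power2 tinner_def
        sum.distrib sum_subtractf sum_distrib_left)
qed

text \<open>Eliminating the optimal weight turns the weighted quadratic back into the Cauchy loss.\<close>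

lemma cauchy_weight_value:
  assumes "\<delta> > 0"
  shows "cauchy_weight \<delta> x / 2 * x\<^sup>2 + \<delta>\<^sup>2 / 2 * rho (cauchy_weight \<delta> x)
    = \<delta>\<^sup>2 / 2 * ln (1 + x\<^sup>2 / \<delta>\<^sup>2)"
proof -
  have pos: "\<delta>\<^sup>2 + x\<^sup>2 > 0"
    using assms by (simp add: add_pos_nonneg)
  have "cauchy_weight \<delta> x = inverse (1 + x\<^sup>2 / \<delta>\<^sup>2)"
    using assms pos by (simp add: cauchy_weight_def field_simps)
  then have "ln (cauchy_weight \<delta> x) = - ln (1 + x\<^sup>2 / \<delta>\<^sup>2)"
    using assms by (simp add: ln_inverse add_pos_nonneg)
  moreover have "cauchy_weight \<delta> x * (\<delta>\<^sup>2 + x\<^sup>2) = \<delta>\<^sup>2"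
    using pos by (simp add: cauchy_weight_def)
  then have "cauchy_weight \<delta> x / 2 * x\<^sup>2 = \<delta>\<^sup>2 / 2 * (1 - cauchy_weight \<delta> x)"
    by (simp add: algebra_simps)
  ultimately show ?thesis
    by (simp add: rho_def algebra_simps)
qed

lemma cauchy_weight_minimises:
  assumes "\<delta> > 0" "w > 0"
  shows "cauchy_weight \<delta> x / 2 * x\<^sup>2 + \<delta>\<^sup>2 / 2 * rho (cauchy_weight \<delta> x)
    \<le> w / 2 * x\<^sup>2 + \<delta>\<^sup>2 / 2 * rho w"
proof -
  define z where "z = 1 + x\<^sup>2 / \<delta>\<^sup>2"
  have z: "z > 0"
    using assms by (simp add: z_def add_pos_nonneg)
  have "ln (w * z) \<le> w * z - 1"
    using assms z by (intro ln_le_minus_one) simp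
  then have "\<delta>\<^sup>2 / 2 * ln z \<le> \<delta>\<^sup>2 / 2 * (w * z - ln w - 1)"
    using assms z by (intro mult_left_mono) (auto simp: ln_mult)
  moreover have "\<delta>\<^sup>2 * z = \<delta>\<^sup>2 + x\<^sup>2"
    using assms by (simp add: z_def distrib_left)
  then have "w * (\<delta>\<^sup>2 * z) = w * \<delta>\<^sup>2 + w * x\<^sup>2"
    by (simp add: distrib_left)
  then have eq: "w / 2 * x\<^sup>2 = \<delta>\<^sup>2 / 2 * (w * z - w)"
    by (simp add: algebra_simps)
  have "w / 2 * x\<^sup>2 + \<delta>\<^sup>2 / 2 * rho w = \<delta>\<^sup>2 / 2 * (w * z - ln w - 1)"
  proof -
    have "c * (p - w) + c * (w - q - 1) = c * (p - q - 1)" for c p q :: real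
      by (simp add: algebra_simps)
    then show ?thesis
      unfolding eq rho_def by blast
  qed
  ultimately show ?thesis
    unfolding cauchy_weight_value[OF assms(1)] z_def[symmetric] by simp
qed

text \<open>The effect of the updates of \<open>T\<close>, \<open>Y\<close> and \<open>W\<close> on one entry: a strongly convex quadratic is
  minimised in \<open>t\<close>, the dual ascent step costs \<open>(y' - y)\<^sup>2 / \<tau>\<close>, and \<open>w'\<close> minimises in \<open>w\<close>.\<close>

lemma entry_lagrangian_step:
  assumes "\<delta> > 0" "\<tau> > 0" "w > 0"
    and t': "(w + \<tau>) * t' = w * a - y + \<tau> * s"
    and y': "y' = y - \<tau> * (s - t')"
    and w': "w' = cauchy_weight \<delta> (t' - a)"
  shows "entry_lagrangian \<tau> \<delta> a s t' y' w' + \<tau> / 2 * (t' - t)\<^sup>2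
    \<le> entry_lagrangian \<tau> \<delta> a s t y w + (y' - y)\<^sup>2 / \<tau>"
proof -
  have "entry_lagrangian \<tau> \<delta> a s t' y' w' \<le> entry_lagrangian \<tau> \<delta> a s t' y' w"
    using cauchy_weight_minimises[OF assms(1,3), of "t' - a"]
    by (simp add: entry_lagrangian_def w' power2_commute)
  moreover have "entry_lagrangian \<tau> \<delta> a s t' y' w = entry_lagrangian \<tau> \<delta> a s t' y w + (y' - y)\<^sup>2 / \<tau>"
    using assms(2) by (simp add: entry_lagrangian_def y' field_simps power2_eq_square)
  moreover have "entry_lagrangian \<tau> \<delta> a s t y w
      = entry_lagrangian \<tau> \<delta> a s t' y w + (w + \<tau>) / 2 * (t' - t)\<^sup>2"
  proof -
    \<comment> \<open>second-order Taylor expansion at \<open>t'\<close>; the first-order term vanishes by the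
      equation for \<open>t'\<close>\<close>
    have "entry_lagrangian \<tau> \<delta> a s t y w = entry_lagrangian \<tau> \<delta> a s t' y w
        + (w + \<tau>) / 2 * (t' - t)\<^sup>2 + (t - t') * ((w + \<tau>) * t' - (w * a - y + \<tau> * s))"
      unfolding entry_lagrangian_def by (simp add: field_simps power2_eq_square)
    then show ?thesis
      by (simp add: t')
  qed
  moreover have "\<tau> / 2 * (t' - t)\<^sup>2 \<le> (w + \<tau>) / 2 * (t' - t)\<^sup>2"
    using assms(3) by (intro mult_right_mono) auto
  ultimately show ?thesis
    by simp
qed

section \<open>Descent in the factors and in the coefficients\<close>

context cp_problem
begin

text \<open>With orthonormal rank-one terms the squared norm of the approximation does not depend on the
  factors, so the augmented Lagrangian is affine in the inner products with the rank-one terms.\<close>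

lemma aug_lagrangian_diff:
  assumes "feasible d n R t U" "feasible d n R t U'"
  shows "aug_lagrangian d n R \<tau> \<delta> A \<sigma> U T Y W - aug_lagrangian d n R \<tau> \<delta> A \<sigma>' U' T Y W
    = tinner d n (\<lambda>I. Y I + \<tau> * T I) (cp d R \<sigma>' U') - tinner d n (\<lambda>I. Y I + \<tau> * T I) (cp d R \<sigma> U)
      + \<tau> / 2 * ((\<Sum>i\<in>{1..R}. (\<sigma> i)\<^sup>2) - (\<Sum>i\<in>{1..R}. (\<sigma>' i)\<^sup>2))"
proof -
  have *: "(tnorm d n (\<lambda>I. cp d R \<sigma> U I - T I))\<^sup>2
      = (\<Sum>i\<in>{1..R}. (\<sigma> i)\<^sup>2) - 2 * tinner d n T (cp d R \<sigma> U) + tinner d n T T"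
    if "feasible d n R t U" for \<sigma> U
    unfolding tinner_cp_cp[OF that, symmetric] tnorm_power2
    by (simp add: tinner_def power2_eq_square algebra_simps sum.distrib sum_subtractf
        sum_distrib_left)
  show ?thesis
    unfolding aug_lagrangian_def *[OF assms(1)] *[OF assms(2)] tinner_diff_right tinner_add_left
    by (simp add: algebra_simps)
qed

lemma coefficient_update_descent:
  assumes "\<tau> \<noteq> 0" and U: "feasible d n R t U"
    and \<sigma>': "\<And>i. i \<in> {1..R} \<Longrightarrow> \<sigma>' i = tinner d n (\<lambda>I. Y I + \<tau> * T I) (r1 U i) / \<tau>"
  shows "aug_lagrangian d n R \<tau> \<delta> A \<sigma>' U T Y W
    = aug_lagrangian d n R \<tau> \<delta> A \<sigma> U T Y W - \<tau> / 2 * (\<Sum>i\<in>{1..R}. (\<sigma>' i - \<sigma> i)\<^sup>2)"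
proof -
  have "tinner d n (\<lambda>I. Y I + \<tau> * T I) (cp d R s U) = \<tau> * (\<Sum>i\<in>{1..R}. s i * \<sigma>' i)" for s
    unfolding tinner_cp sum_distrib_left using assms(1) \<sigma>' by (intro sum.cong) auto
  then have "aug_lagrangian d n R \<tau> \<delta> A \<sigma> U T Y W - aug_lagrangian d n R \<tau> \<delta> A \<sigma>' U T Y W
      = \<tau> * (\<Sum>i\<in>{1..R}. \<sigma>' i * \<sigma>' i) - \<tau> * (\<Sum>i\<in>{1..R}. \<sigma> i * \<sigma>' i)
        + \<tau> / 2 * ((\<Sum>i\<in>{1..R}. (\<sigma> i)\<^sup>2) - (\<Sum>i\<in>{1..R}. (\<sigma>' i)\<^sup>2))"
    by (simp add: aug_lagrangian_diff[OF U U])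
  also have "\<dots> = \<tau> / 2 * (\<Sum>i\<in>{1..R}. (\<sigma>' i - \<sigma> i)\<^sup>2)"
    by (simp add: power2_diff sum.distrib sum_subtractf sum_distrib_left power2_eq_square
        algebra_simps)
  finally show ?thesis
    by simp
qed

end

text \<open>Passing from \<open>u\<close> to \<open>u'\<close> one mode at a time telescopes.\<close>

lemma tinner_rank_one_telescope:
  "tinner d n X (rank_one d u') - tinner d n X (rank_one d u)
   = (\<Sum>j\<in>{1..d}. vinner (n j) (contract d n X (\<lambda>l. if l < j then u' l else u l) j)
                          (\<lambda>p. u' j p - u j p))"
proof -
  define h where "h j = tinner d n X (rank_one d (\<lambda>l. if l \<le> j then u' l else u l))" for j
  have "vinner (n j) (contract d n X (\<lambda>l. if l < j then u' l else u l) j) (\<lambda>p. u' j p - u j p)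
      = h j - h (j - 1)" if j: "j \<in> {1..d}" for j
  proof -
    have c1: "contract d n X (\<lambda>l. if l \<le> j then u' l else u l) j
        = contract d n X (\<lambda>l. if l < j then u' l else u l) j"
      by (rule contract_cong) auto
    have c2: "contract d n X (\<lambda>l. if l \<le> j - 1 then u' l else u l) j
        = contract d n X (\<lambda>l. if l < j then u' l else u l) j"
      using j by (intro contract_cong) auto
    have "\<not> j \<le> j - 1"
      using j by auto
    then show ?thesis
      unfolding h_def tinner_rank_one_contract[OF j] vinner_diff_right c1 c2 by simp
  qed
  then have "(\<Sum>j\<in>{1..d}. vinner (n j) (contract d n X (\<lambda>l. if l < j then u' l else u l) j)
        (\<lambda>p. u' j p - u j p)) = (\<Sum>j\<in>{Suc 0..d}. h j - h (j - 1))"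
    by (intro sum.cong) auto
  also have "\<dots> = h d - h 0"
    by (rule sum_telescope'') simp
  also have "h d = tinner d n X (rank_one d u')"
    unfolding h_def by (rule tinner_cong) (auto simp: rank_one_def intro!: prod.cong)
  also have "h 0 = tinner d n X (rank_one d u)"
    unfolding h_def by (rule tinner_cong) (auto simp: rank_one_def intro!: prod.cong)
  finally show ?thesis
    by simp
qed

context cp_problem
begin

lemma factor_update_feasible:
  assumes "factor_update d n R t \<alpha> \<tau> \<sigma> T Y U U'"
  shows "feasible d n R t U'"
  unfolding feasible_def
proof (intro conjI ballI)
  fix j i assume ji: "j \<in> {1..d - t}" "i \<in> {1..R}"
  let ?v = "update_dir d n \<alpha> \<tau> \<sigma> T Y U U' j i"
  have "vnorm (n j) ?v \<noteq> 0" "\<forall>p\<in>{1..n j}. U' j i p = ?v p / vnorm (n j) ?v"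
    using assms ji unfolding factor_update_def Let_def by blast+
  then show "vnorm (n j) (U' j i) = 1"
    by (intro vnorm_normalised(1)[of "n j" ?v]) auto
next
  fix j assume j: "j \<in> {d - t + 1..d}"
  then show "orthonormal_cols (n j) R (U' j)"
    using assms unfolding factor_update_def Let_def is_arg_max_def by blast
qed

text \<open>In either kind of mode the new factor maximises the inner product with the update direction
  over a set that contains the old factor.\<close>

lemma factor_update_maximises:
  assumes up: "factor_update d n R t \<alpha> \<tau> \<sigma> T Y U U'" and U: "feasible d n R t U"
    and j: "j \<in> {1..d}"
  defines "V \<equiv> update_dir d n \<alpha> \<tau> \<sigma> T Y U U' j"
  shows "minner (n j) R V (U j) \<le> minner (n j) R V (U' j)"
  using j
proof (cases rule: modes_cases)
  case 1
  have "vinner (n j) (V i) (U j i) \<le> vinner (n j) (V i) (U' j i)" if i: "i \<in> {1..R}" for i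
  proof -
    have "vnorm (n j) (V i) \<noteq> 0" "\<forall>p\<in>{1..n j}. U' j i p = V i p / vnorm (n j) (V i)"
      using up 1 i unfolding V_def factor_update_def Let_def by blast+
    then have "vinner (n j) (V i) (U' j i) = vnorm (n j) (V i)"
      by (intro vnorm_normalised(2)) auto
    then show ?thesis
      using vinner_le_vnorm[of "n j" "V i" "U j i"] feasible_vnorm[OF U j i] by simp
  qed
  then show ?thesis
    unfolding minner_vinner by (rule sum_mono)
next
  case 2
  then have "is_arg_max (minner (n j) R V) (orthonormal_cols (n j) R) (U' j)"
    using up unfolding V_def factor_update_def Let_def by blast
  moreover have "orthonormal_cols (n j) R (U j)"
    using U 2 unfolding feasible_def by blast
  ultimately show ?thesis
    by (auto simp: is_arg_max_linorder)
qed

text \<open>The proximal term \<open>\<alpha> u\<close> in the update direction is what buys the descent: for unit vectors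
  \<open>- \<langle>u, u' - u\<rangle> = \<parallel>u' - u\<parallel>\<^sup>2 / 2\<close>.\<close>

lemma factor_update_ascent:
  assumes up: "factor_update d n R t \<alpha> \<tau> \<sigma> T Y U U'" and U: "feasible d n R t U"
  shows "\<alpha> / 2 * (\<Sum>j\<in>{1..d}. (mnorm (n j) R (\<lambda>i p. U' j i p - U j i p))\<^sup>2)
    \<le> tinner d n (\<lambda>I. Y I + \<tau> * T I) (cp d R \<sigma> U') - tinner d n (\<lambda>I. Y I + \<tau> * T I) (cp d R \<sigma> U)"
proof -
  let ?X = "\<lambda>I. Y I + \<tau> * T I"
  let ?V = "update_dir d n \<alpha> \<tau> \<sigma> T Y U U'"
  let ?c = "\<lambda>j i. contract d n ?X (\<lambda>l. if l < j then U' l i else U l i) j"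
  have U': "feasible d n R t U'"
    using up by (rule factor_update_feasible)
  have entry: "\<sigma> i * vinner (n j) (?c j i) (\<lambda>p. U' j i p - U j i p)
      = (vinner (n j) (?V j i) (U' j i) - vinner (n j) (?V j i) (U j i))
        + \<alpha> / 2 * vinner (n j) (\<lambda>p. U' j i p - U j i p) (\<lambda>p. U' j i p - U j i p)"
    if j: "j \<in> {1..d}" and i: "i \<in> {1..R}" for j i
  proof -
    have V: "vinner (n j) (?V j i) w = \<sigma> i * vinner (n j) (?c j i) w + \<alpha> * vinner (n j) (U j i) w" for w
      by (simp add: vinner_def update_dir_def distrib_right sum.distrib sum_distrib_left mult.assoc)
    have "vinner (n j) (\<lambda>p. U' j i p - U j i p) (\<lambda>p. U' j i p - U j i p)
        = vinner (n j) (U' j i) (U' j i) + vinner (n j) (U j i) (U j i) - 2 * vinner (n j) (U j i) (U' j i)"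
      by (simp add: vinner_def sum.distrib sum_subtractf sum_distrib_left algebra_simps)
    then have sq: "vinner (n j) (\<lambda>p. U' j i p - U j i p) (\<lambda>p. U' j i p - U j i p)
        = 2 - 2 * vinner (n j) (U j i) (U' j i)"
      by (simp add: feasible_unit[OF U j i] feasible_unit[OF U' j i])
    show ?thesis
      unfolding sq unfolding V vinner_diff_right
      by (simp add: feasible_unit[OF U j i] algebra_simps)
  qed
  have "tinner d n ?X (cp d R \<sigma> U') - tinner d n ?X (cp d R \<sigma> U)
      = (\<Sum>i\<in>{1..R}. \<sigma> i * (tinner d n ?X (r1 U' i) - tinner d n ?X (r1 U i)))"
    by (simp add: tinner_cp sum_subtractf right_diff_distrib)
  also have "\<dots> = (\<Sum>i\<in>{1..R}. \<Sum>j\<in>{1..d}. \<sigma> i * vinner (n j) (?c j i) (\<lambda>p. U' j i p - U j i p))"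
    by (simp add: tinner_rank_one_telescope sum_distrib_left)
  also have "\<dots> = (\<Sum>j\<in>{1..d}. \<Sum>i\<in>{1..R}. \<sigma> i * vinner (n j) (?c j i) (\<lambda>p. U' j i p - U j i p))"
    by (rule sum.swap)
  also have "\<dots> = (\<Sum>j\<in>{1..d}. (minner (n j) R (?V j) (U' j) - minner (n j) R (?V j) (U j))
        + \<alpha> / 2 * (mnorm (n j) R (\<lambda>i p. U' j i p - U j i p))\<^sup>2)"
    by (intro sum.cong refl)
      (simp add: entry sum.distrib sum_subtractf minner_vinner mnorm_power2 sum_distrib_left)
  also have "\<dots> \<ge> (\<Sum>j\<in>{1..d}. \<alpha> / 2 * (mnorm (n j) R (\<lambda>i p. U' j i p - U j i p))\<^sup>2)"
    using factor_update_maximises[OF up U] by (intro sum_mono) simp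
  finally show ?thesis
    by (simp add: sum_distrib_left)
qed

end

section \<open>Sequences of tuples\<close>

lemma tnorm_L2_set: "tnorm d n X = L2_set X (tidx d n)"
  by (simp add: tnorm_def tinner_def L2_set_def power2_eq_square)

lemma mnorm_L2_set: "mnorm m R M = L2_set (\<lambda>(i, p). M i p) ({1..R} \<times> {1..m})"
  by (simp add: mnorm_def minner_def L2_set_def power2_eq_square sum.cartesian_product case_prod_beta)

lemma L2_set_tendsto_zero_iff:
  assumes "finite S"
  shows "(\<lambda>k. L2_set (f k) S) \<longlonglongrightarrow> 0 \<longleftrightarrow> (\<forall>x\<in>S. (\<lambda>k. f k x) \<longlonglongrightarrow> 0)"
proof (intro iffI ballI)
  fix x assume lim: "(\<lambda>k. L2_set (f k) S) \<longlonglongrightarrow> 0" and x: "x \<in> S"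
  have "norm (f k x) \<le> L2_set (f k) S" for k
    using member_le_L2_set[OF assms x, of "\<lambda>x. \<bar>f k x\<bar>"] by (simp add: L2_set_def)
  then show "(\<lambda>k. f k x) \<longlonglongrightarrow> 0"
    by (intro Lim_null_comparison[OF _ lim]) simp
next
  assume "\<forall>x\<in>S. (\<lambda>k. f k x) \<longlonglongrightarrow> 0"
  then have "(\<lambda>k. \<Sum>x\<in>S. \<bar>f k x\<bar>) \<longlonglongrightarrow> 0"
    by (intro tendsto_null_sum tendsto_rabs_zero) blast
  then show "(\<lambda>k. L2_set (f k) S) \<longlonglongrightarrow> 0"
    by (rule Lim_null_comparison[rotated]) (simp add: L2_set_le_sum_abs)
qed

lemma null_if_power2_null: "(\<lambda>k. (x k :: real)\<^sup>2) \<longlonglongrightarrow> 0 \<Longrightarrow> x \<longlonglongrightarrow> 0"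
  by (simp add: power_tendsto_0_iff)

lemma Bseq_plus:
  fixes f g :: "nat \<Rightarrow> real"
  assumes "Bseq f" "Bseq g"
  shows "Bseq (\<lambda>k. f k + g k)"
proof -
  from assms obtain B B' where "\<And>k. \<bar>f k\<bar> \<le> B" "\<And>k. \<bar>g k\<bar> \<le> B'"
    unfolding Bseq_def by auto
  then have "norm (f k + g k) \<le> B + B'" for k
    by (simp add: abs_triangle_ineq[THEN order_trans] add_mono)
  then show ?thesis
    by (rule BseqI')
qed

lemma Bseq_sum:
  assumes "finite S" "\<And>x. x \<in> S \<Longrightarrow> Bseq (f x)"
  shows "Bseq (\<lambda>k. \<Sum>x\<in>S. f x k :: real)"
  using assms
proof (induction S rule: finite_induct)
  case (insert x S)
  then have "Bseq (\<lambda>k. f x k + (\<Sum>x\<in>S. f x k))"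
    by (intro Bseq_plus) auto
  then show ?case
    using insert.hyps by simp
qed simp

lemma Bseq_L2_set:
  assumes "finite S" "\<And>x. x \<in> S \<Longrightarrow> Bseq (\<lambda>k. f k x)"
  shows "Bseq (\<lambda>k. L2_set (f k) S)"
proof -
  have "Bseq (\<lambda>k. \<Sum>x\<in>S. \<bar>f k x\<bar>)"
    using assms by (intro Bseq_sum) (auto simp: Bseq_def)
  then show ?thesis
    by (rule Bseq_eventually_mono[rotated]) (simp add: L2_set_le_sum_abs sum_nonneg)
qed

lemma summable_if_le_decrease:
  fixes D x :: "nat \<Rightarrow> real"
  assumes "c > 0" "\<And>k. 0 \<le> D k" "\<And>k. x (Suc k) + c * D k \<le> x k" "convergent x"
  shows "summable D"
proof -
  have "summable (\<lambda>k. (x k - x (Suc k)) / c)"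
    using assms(4) by (auto simp: convergent_def intro!: summable_divide telescope_summable')
  moreover have "norm (D k) \<le> (x k - x (Suc k)) / c" for k
    using assms(1) assms(2)[of k] assms(3)[of k] by (simp add: field_simps)
  ultimately show ?thesis
    by (rule summable_comparison_test'[where N = 0])
qed

lemma abs_mult_le_if_le_1: "0 \<le> w \<Longrightarrow> w \<le> 1 \<Longrightarrow> \<bar>w * x\<bar> \<le> \<bar>x :: real\<bar>"
  by (simp add: abs_mult mult_left_le_one_le)

lemma power2_add_le: "(a + b)\<^sup>2 \<le> 2 * a\<^sup>2 + 2 * (b :: real)\<^sup>2"
  using sum_squares_bound[of a b] by (simp add: power2_sum)

text \<open>Bounding \<open>\<bar>y'\<bar>\<close> by \<open>\<delta> / 2 + \<bar>t' - t\<bar>\<close> makes the proximal term \<open>2 / \<tau> (t' - t)\<^sup>2\<close> large enough to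
  compensate for the only negative contribution, \<open>- y'\<^sup>2 / (2 \<tau>)\<close>, up to a constant.\<close>

lemma entry_lagrangian_lower:
  assumes "\<delta> > 0" "\<tau> > 0"
    and w': "w' = cauchy_weight \<delta> (t' - a)" and y': "y' = cauchy_weight \<delta> (t - a) * (a - t')"
  shows "\<delta>\<^sup>2 / 2 * ln (1 + (t' - a)\<^sup>2 / \<delta>\<^sup>2) + (t' - t)\<^sup>2 / \<tau> - \<delta>\<^sup>2 / (4 * \<tau>)
    \<le> entry_lagrangian \<tau> \<delta> a s t' y' w' + 2 / \<tau> * (t' - t)\<^sup>2"
proof -
  let ?c = "cauchy_weight \<delta> (t - a)"
  have c: "0 < ?c" "?c \<le> 1"
    using assms(1) by (simp_all add: cauchy_weight_pos cauchy_weight_le_1)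
  have "y' = - (?c * (t - a)) + ?c * (t - t')"
    by (simp add: y' algebra_simps)
  then have "\<bar>y'\<bar> \<le> \<bar>?c * (t - a)\<bar> + \<bar>?c * (t - t')\<bar>"
    using abs_triangle_ineq[of "- (?c * (t - a))" "?c * (t - t')"] by simp
  also have "\<bar>?c * (t - a)\<bar> \<le> \<delta> / 2"
    using assms(1) by (rule cauchy_weight_mult_le)
  also have "\<bar>?c * (t - t')\<bar> \<le> \<bar>t' - t\<bar>"
    using abs_mult_le_if_le_1[of ?c "t - t'"] c by (simp add: abs_minus_commute)
  finally have "y'\<^sup>2 \<le> (\<delta> / 2 + \<bar>t' - t\<bar>)\<^sup>2"
    using assms(1) by (intro power2_le_iff_abs_le[THEN iffD2]) auto
  also have "\<dots> \<le> \<delta>\<^sup>2 / 2 + 2 * (t' - t)\<^sup>2"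
    using power2_add_le[of "\<delta> / 2" "\<bar>t' - t\<bar>"] by (simp add: power_divide)
  finally have "y'\<^sup>2 / (2 * \<tau>) \<le> (\<delta>\<^sup>2 / 2 + 2 * (t' - t)\<^sup>2) / (2 * \<tau>)"
    using assms(2) by (intro divide_right_mono) auto
  also have "\<dots> = \<delta>\<^sup>2 / (4 * \<tau>) + (t' - t)\<^sup>2 / \<tau>"
    using assms(2) by (simp add: field_simps)
  finally have 1: "y'\<^sup>2 / (2 * \<tau>) \<le> \<delta>\<^sup>2 / (4 * \<tau>) + (t' - t)\<^sup>2 / \<tau>" .
  \<comment> \<open>completing the square in the residual \<open>s - t'\<close>\<close>
  have "0 \<le> \<tau> / 2 * ((s - t') - y' / \<tau>)\<^sup>2"
    using assms(2) by simp
  also have "\<dots> = \<tau> / 2 * (s - t')\<^sup>2 - y' * (s - t') + y'\<^sup>2 / (2 * \<tau>)"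
    using assms(2) by (simp add: power2_eq_square field_simps)
  finally have 2: "- (y'\<^sup>2 / (2 * \<tau>)) \<le> \<tau> / 2 * (s - t')\<^sup>2 - y' * (s - t')"
    by simp
  have 3: "w' / 2 * (a - t')\<^sup>2 + \<delta>\<^sup>2 / 2 * rho w' = \<delta>\<^sup>2 / 2 * ln (1 + (t' - a)\<^sup>2 / \<delta>\<^sup>2)"
    using cauchy_weight_value[OF assms(1), of "t' - a"] by (simp add: w' power2_commute)
  have "2 / \<tau> * (t' - t)\<^sup>2 = 2 * ((t' - t)\<^sup>2 / \<tau>)"
    by simp
  then show ?thesis
    using 1 2 unfolding entry_lagrangian_def 3 by linarith
qed

section \<open>Descent along a run\<close>

locale hq_admm_run = cp_problem +
  fixes \<alpha> \<tau> \<delta> :: real and A :: tensor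
    and \<sigma> :: "nat \<Rightarrow> rvec" and U :: "nat \<Rightarrow> factors" and T Y W :: "nat \<Rightarrow> tensor"
  assumes delta_pos: "\<delta> > 0" and alpha_pos: "\<alpha> > 0" and tau_ge: "\<tau> \<ge> sqrt 10"
    and run: "hq_admm d n R t \<alpha> \<tau> \<delta> A \<sigma> U T Y W"
begin

lemma tau_pos: "\<tau> > 0"
  using tau_ge by (rule less_le_trans[rotated]) simp

lemma tau_square: "\<tau>\<^sup>2 \<ge> 10"
  using power_mono[OF tau_ge, of 2] by simp

lemma factors_step: "factor_update d n R t \<alpha> \<tau> (\<sigma> k) (T k) (Y k) (U k) (U (Suc k))"
  using run unfolding hq_admm_def by blast

lemma feasible_run: "feasible d n R t (U k)"
proof (cases k)
  case 0
  then show ?thesis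
    using run by (simp add: hq_admm_def)
next
  case (Suc l)
  then show ?thesis
    using factor_update_feasible[OF factors_step] by simp
qed

lemma sigma_eq:
  "i \<in> {1..R} \<Longrightarrow>
     \<sigma> (Suc k) i = tinner d n (\<lambda>I. Y (Suc k) I + \<tau> * T (Suc k) I) (r1 (U (Suc k)) i) / \<tau>"
  using run unfolding hq_admm_def by blast

context
  fixes I assumes I: "I \<in> tidx d n"
begin

lemma W_eq: "W (Suc k) I = cauchy_weight \<delta> (T (Suc k) I - A I)"
  using run I unfolding hq_admm_def cauchy_weight_def by blast

lemma W_pos: "0 < W (Suc k) I"
  by (simp add: W_eq cauchy_weight_pos delta_pos)

lemma W_le_1: "W (Suc k) I \<le> 1"
  by (simp add: W_eq cauchy_weight_le_1 delta_pos)

lemma W_nonneg: "0 \<le> W k I"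
proof (cases k)
  case 0
  then show ?thesis
    using run I by (simp add: hq_admm_def)
next
  case (Suc l)
  then show ?thesis
    using W_pos[of l] by simp
qed

lemma T_eq: "(W k I + \<tau>) * T (Suc k) I = W k I * A I - Y k I + \<tau> * cp d R (\<sigma> k) (U (Suc k)) I"
proof -
  have "T (Suc k) I = (W k I * A I - Y k I + \<tau> * cp d R (\<sigma> k) (U (Suc k)) I) / (W k I + \<tau>)"
    using run I unfolding hq_admm_def by blast
  moreover have "W k I + \<tau> > 0"
    using W_nonneg[of k] tau_pos by simp
  ultimately show ?thesis
    by simp
qed

lemma Y_step: "Y (Suc k) I = Y k I - \<tau> * (cp d R (\<sigma> k) (U (Suc k)) I - T (Suc k) I)"
  using run I unfolding hq_admm_def by blast

text \<open>The optimality condition of the tensor update, rewritten with the new multiplier.\<close>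

lemma Y_eq: "Y (Suc k) I = W k I * (A I - T (Suc k) I)"
  using T_eq[of k] Y_step[of k] by (simp add: algebra_simps)

text \<open>Both \<open>W (k + 2)\<close> and \<open>W (k + 1)\<close> must be Cauchy weights for this; the initial \<open>W 0\<close> is arbitrary,
  which is why the descent below starts at index 1.\<close>

lemma Y_diff_le:
  "\<bar>Y (Suc (Suc (Suc k))) I - Y (Suc (Suc k)) I\<bar>
   \<le> \<bar>T (Suc (Suc (Suc k))) I - T (Suc (Suc k)) I\<bar> + \<bar>T (Suc (Suc k)) I - T (Suc k) I\<bar>"
proof -
  let ?k1 = "Suc k" let ?k2 = "Suc (Suc k)" let ?k3 = "Suc (Suc (Suc k))"
  have "\<bar>Y ?k3 I - Y ?k2 I\<bar>
      = \<bar>W ?k2 I * (T ?k2 I - T ?k3 I) - (W ?k2 I - W ?k1 I) * (T ?k2 I - A I)\<bar>"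
    by (simp add: Y_eq algebra_simps)
  also have "\<dots> \<le> \<bar>W ?k2 I * (T ?k2 I - T ?k3 I)\<bar> + \<bar>(W ?k2 I - W ?k1 I) * (T ?k2 I - A I)\<bar>"
    by (rule abs_triangle_ineq4)
  also have "\<bar>W ?k2 I * (T ?k2 I - T ?k3 I)\<bar> \<le> \<bar>T ?k3 I - T ?k2 I\<bar>"
    using abs_mult_le_if_le_1[OF W_nonneg[of ?k2] W_le_1[of ?k1], of "T ?k2 I - T ?k3 I"]
    by (simp only: abs_minus_commute)
  also have "\<bar>(W ?k2 I - W ?k1 I) * (T ?k2 I - A I)\<bar> \<le> \<bar>T ?k2 I - T ?k1 I\<bar>"
    using cauchy_weight_diff_mult_le[OF delta_pos, of "T ?k2 I - A I" "T ?k1 I - A I"]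
    by (simp add: W_eq)
  finally show ?thesis
    by simp
qed

lemma Y_le: "\<bar>Y (Suc (Suc k)) I\<bar> \<le> \<bar>T (Suc (Suc k)) I - A I\<bar>"
  unfolding Y_eq
  using abs_mult_le_if_le_1[OF W_nonneg[of "Suc k"] W_le_1[of k], of "A I - T (Suc (Suc k)) I"]
  by (simp only: abs_minus_commute)

lemma W_diff_le: "\<bar>W (Suc (Suc k)) I - W (Suc k) I\<bar> \<le> \<bar>T (Suc (Suc k)) I - T (Suc k) I\<bar> / \<delta>"
  using cauchy_weight_lipschitz[OF delta_pos, of "T (Suc (Suc k)) I - A I" "T (Suc k) I - A I"]
  by (simp add: W_eq)

end

abbreviation "L k \<equiv> aug_lagrangian d n R \<tau> \<delta> A (\<sigma> k) (U k) (T k) (Y k) (W k)"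

abbreviation "Lprox k \<equiv> aug_lagrangian_prox d n R \<tau> \<delta> A
  (\<sigma> (Suc k)) (U (Suc k)) (T (Suc k)) (Y (Suc k)) (W (Suc k)) (T k)"

definition "step_U k = (\<Sum>j\<in>{1..d}. (mnorm (n j) R (\<lambda>i p. U (Suc k) j i p - U k j i p))\<^sup>2)"
definition "step_T k = (tnorm d n (\<lambda>I. T (Suc k) I - T k I))\<^sup>2"
definition "step_Y k = (tnorm d n (\<lambda>I. Y (Suc k) I - Y k I))\<^sup>2"
definition "step_sigma k = (vnorm R (\<lambda>i. \<sigma> (Suc k) i - \<sigma> k i))\<^sup>2"

lemma step_nonneg: "0 \<le> step_U k" "0 \<le> step_T k" "0 \<le> step_sigma k"
  by (simp_all add: step_U_def step_T_def step_sigma_def sum_nonneg)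

text \<open>Of the five updates only the dual ascent step can raise the augmented Lagrangian.\<close>

lemma lagrangian_step:
  assumes W: "\<And>I. I \<in> tidx d n \<Longrightarrow> 0 < W k I"
  shows "L (Suc k) + \<alpha> / 2 * step_U k + \<tau> / 2 * step_T k + \<tau> / 2 * step_sigma k
    \<le> L k + step_Y k / \<tau>"
proof -
  let ?L1 = "aug_lagrangian d n R \<tau> \<delta> A (\<sigma> k) (U (Suc k)) (T k) (Y k) (W k)"
  let ?L2 = "aug_lagrangian d n R \<tau> \<delta> A (\<sigma> k) (U (Suc k)) (T (Suc k)) (Y (Suc k)) (W (Suc k))"
  have 1: "?L1 + \<alpha> / 2 * step_U k \<le> L k"
    using factor_update_ascent[OF factors_step feasible_run, of k]
      aug_lagrangian_diff[OF feasible_run[of k] feasible_run[of "Suc k"], where \<tau> = \<tau> and \<delta> = \<delta> and A = A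
        and \<sigma> = "\<sigma> k" and \<sigma>' = "\<sigma> k" and T = "T k" and Y = "Y k" and W = "W k"]
    by (simp add: step_U_def)
  have "(\<Sum>I\<in>tidx d n. entry_lagrangian \<tau> \<delta> (A I) (cp d R (\<sigma> k) (U (Suc k)) I)
          (T (Suc k) I) (Y (Suc k) I) (W (Suc k) I) + \<tau> / 2 * (T (Suc k) I - T k I)\<^sup>2)
      \<le> (\<Sum>I\<in>tidx d n. entry_lagrangian \<tau> \<delta> (A I) (cp d R (\<sigma> k) (U (Suc k)) I)
          (T k I) (Y k I) (W k I) + (Y (Suc k) I - Y k I)\<^sup>2 / \<tau>)"
    using W delta_pos tau_pos by (intro sum_mono entry_lagrangian_step) (auto simp: T_eq Y_step W_eq)
  then have 2: "?L2 + \<tau> / 2 * step_T k \<le> ?L1 + step_Y k / \<tau>"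
    by (simp add: aug_lagrangian_entries W_nonneg step_T_def step_Y_def tnorm_power2
        sum.distrib sum_distrib_left sum_divide_distrib)
  have 3: "L (Suc k) = ?L2 - \<tau> / 2 * step_sigma k"
    using coefficient_update_descent[OF _ feasible_run[of "Suc k"] sigma_eq[of _ k], where \<delta> = \<delta> and A = A
        and W = "W (Suc k)" and \<sigma> = "\<sigma> k"] tau_pos
    by (simp add: step_sigma_def vnorm_def L2_set_def sum_nonneg)
  show ?thesis
    using 1 2 3 by linarith
qed

lemma step_Y_le: "step_Y (Suc (Suc k)) \<le> 2 * step_T (Suc (Suc k)) + 2 * step_T (Suc k)"
proof -
  let ?k2 = "Suc (Suc k)"
  have "(Y (Suc ?k2) I - Y ?k2 I)\<^sup>2 \<le> 2 * (T (Suc ?k2) I - T ?k2 I)\<^sup>2 + 2 * (T ?k2 I - T (Suc k) I)\<^sup>2"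
    if I: "I \<in> tidx d n" for I
  proof -
    have "(Y (Suc ?k2) I - Y ?k2 I)\<^sup>2 \<le> (\<bar>T (Suc ?k2) I - T ?k2 I\<bar> + \<bar>T ?k2 I - T (Suc k) I\<bar>)\<^sup>2"
      using Y_diff_le[OF I, of k] by (intro power2_le_iff_abs_le[THEN iffD2]) auto
    also have "\<dots> \<le> 2 * (T (Suc ?k2) I - T ?k2 I)\<^sup>2 + 2 * (T ?k2 I - T (Suc k) I)\<^sup>2"
      using power2_add_le[of "\<bar>T (Suc ?k2) I - T ?k2 I\<bar>" "\<bar>T ?k2 I - T (Suc k) I\<bar>"] by simp
    finally show ?thesis .
  qed
  then have "step_Y ?k2
      \<le> (\<Sum>I\<in>tidx d n. 2 * (T (Suc ?k2) I - T ?k2 I)\<^sup>2 + 2 * (T ?k2 I - T (Suc k) I)\<^sup>2)"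
    unfolding step_Y_def tnorm_power2 by (rule sum_mono)
  then show ?thesis
    by (simp add: step_T_def tnorm_power2 sum.distrib sum_distrib_left)
qed

definition "rate = min (\<alpha> / 2) (1 / \<tau>)"

lemma rate_pos: "rate > 0"
  by (simp add: rate_def alpha_pos tau_pos)

text \<open>The gain \<open>\<tau> / 2\<close> from the tensor update pays for \<open>2 / \<tau>\<close> in the dual step, and for the
  \<open>2 / \<tau>\<close> carried over to the next step by the proximal term; \<open>\<tau>\<^sup>2 \<ge> 10\<close> leaves at least
  \<open>1 / \<tau>\<close>.\<close>

lemma Lprox_descent:
  "Lprox (Suc (Suc k)) + rate * (step_U (Suc (Suc k)) + step_T (Suc (Suc k)) + step_sigma (Suc (Suc k)))
   \<le> Lprox (Suc k)"
proof -
  let ?k2 = "Suc (Suc k)"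
  have a: "L (Suc ?k2) + \<alpha> / 2 * step_U ?k2 + \<tau> / 2 * step_T ?k2 + \<tau> / 2 * step_sigma ?k2
      \<le> L ?k2 + step_Y ?k2 / \<tau>"
    by (rule lagrangian_step) (rule W_pos)
  have "step_Y ?k2 / \<tau> \<le> (2 * step_T ?k2 + 2 * step_T (Suc k)) / \<tau>"
    using tau_pos by (intro divide_right_mono step_Y_le) simp
  then have b: "step_Y ?k2 / \<tau> \<le> 2 / \<tau> * step_T ?k2 + 2 / \<tau> * step_T (Suc k)"
    by (simp add: add_divide_distrib)
  have c: "Lprox (Suc k) = L ?k2 + 2 / \<tau> * step_T (Suc k)"
    "Lprox ?k2 = L (Suc ?k2) + 2 / \<tau> * step_T ?k2"
    by (simp_all add: aug_lagrangian_prox_def step_T_def)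
  have t: "5 / \<tau> \<le> \<tau> / 2"
    using tau_square tau_pos by (simp add: field_simps power2_eq_square)
  have "5 / \<tau> * step_T ?k2 \<le> \<tau> / 2 * step_T ?k2"
    using t step_nonneg(2) by (rule mult_right_mono)
  moreover have "rate * step_T ?k2 \<le> 1 / \<tau> * step_T ?k2"
    using step_nonneg by (intro mult_right_mono) (auto simp: rate_def)
  moreover have "5 / \<tau> * step_T ?k2 = 2 / \<tau> * step_T ?k2 + 2 / \<tau> * step_T ?k2 + 1 / \<tau> * step_T ?k2"
    by (simp add: field_simps)
  moreover have "rate * step_U ?k2 \<le> \<alpha> / 2 * step_U ?k2"
    using step_nonneg by (intro mult_right_mono) (auto simp: rate_def)
  moreover have "rate * step_sigma ?k2 \<le> \<tau> / 2 * step_sigma ?k2"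
  proof -
    have "1 / \<tau> \<le> 5 / \<tau>"
      using tau_pos by (simp add: divide_right_mono)
    then have "rate \<le> \<tau> / 2"
      using t by (simp add: rate_def min_le_iff_disj)
    then show ?thesis
      using step_nonneg by (intro mult_right_mono)
  qed
  ultimately show ?thesis
    using a b unfolding c distrib_left by linarith
qed

lemma Lprox_lower:
  "(\<Sum>I\<in>tidx d n. \<delta>\<^sup>2 / 2 * ln (1 + (T (Suc (Suc k)) I - A I)\<^sup>2 / \<delta>\<^sup>2) - \<delta>\<^sup>2 / (4 * \<tau>))
   \<le> Lprox (Suc k)"
proof -
  let ?k1 = "Suc k" and ?k2 = "Suc (Suc k)"
  have "(\<Sum>I\<in>tidx d n. \<delta>\<^sup>2 / 2 * ln (1 + (T ?k2 I - A I)\<^sup>2 / \<delta>\<^sup>2) - \<delta>\<^sup>2 / (4 * \<tau>))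
      \<le> (\<Sum>I\<in>tidx d n. \<delta>\<^sup>2 / 2 * ln (1 + (T ?k2 I - A I)\<^sup>2 / \<delta>\<^sup>2)
           + (T ?k2 I - T ?k1 I)\<^sup>2 / \<tau> - \<delta>\<^sup>2 / (4 * \<tau>))"
    using tau_pos by (intro sum_mono) simp
  also have "\<dots> \<le> (\<Sum>I\<in>tidx d n. entry_lagrangian \<tau> \<delta> (A I) (cp d R (\<sigma> ?k2) (U ?k2) I)
          (T ?k2 I) (Y ?k2 I) (W ?k2 I) + 2 / \<tau> * (T ?k2 I - T ?k1 I)\<^sup>2)"
    using delta_pos tau_pos by (intro sum_mono entry_lagrangian_lower) (auto simp: W_eq Y_eq)
  also have "\<dots> = Lprox ?k1"
    by (simp add: aug_lagrangian_prox_def aug_lagrangian_entries W_nonneg tnorm_power2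
        sum.distrib sum_distrib_left)
  finally show ?thesis .
qed

lemma Lprox_decseq: "decseq (\<lambda>k. Lprox (Suc k))"
proof (rule decseq_SucI)
  fix k
  have "0 \<le> rate * (step_U (Suc (Suc k)) + step_T (Suc (Suc k)) + step_sigma (Suc (Suc k)))"
    using rate_pos step_nonneg by (intro mult_nonneg_nonneg add_nonneg_nonneg) auto
  then show "Lprox (Suc (Suc k)) \<le> Lprox (Suc k)"
    using Lprox_descent[of k] by linarith
qed

definition "Lprox_bound = real (card (tidx d n)) * (\<delta>\<^sup>2 / (4 * \<tau>))"

lemma cauchy_loss_le_Lprox:
  "(\<Sum>I\<in>tidx d n. \<delta>\<^sup>2 / 2 * ln (1 + (T (Suc (Suc k)) I - A I)\<^sup>2 / \<delta>\<^sup>2)) \<le> Lprox (Suc k) + Lprox_bound"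
  using Lprox_lower[of k] by (simp add: sum_subtractf Lprox_bound_def)

lemma loss_entry_nonneg: "0 \<le> \<delta>\<^sup>2 / 2 * ln (1 + x\<^sup>2 / \<delta>\<^sup>2)"
  by simp

lemma Lprox_ge: "- Lprox_bound \<le> Lprox (Suc k)"
proof -
  have "0 \<le> (\<Sum>I\<in>tidx d n. \<delta>\<^sup>2 / 2 * ln (1 + (T (Suc (Suc k)) I - A I)\<^sup>2 / \<delta>\<^sup>2))"
    by (intro sum_nonneg loss_entry_nonneg)
  then show ?thesis
    using cauchy_loss_le_Lprox[of k] by linarith
qed

lemma Lprox_convergent: "convergent (\<lambda>k. Lprox k)"
proof -
  obtain l where "(\<lambda>k. Lprox (Suc k)) \<longlonglongrightarrow> l"
    using decseq_convergent[OF Lprox_decseq, of "- Lprox_bound"] Lprox_ge by blast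
  then have "convergent (\<lambda>k. Lprox (Suc k))"
    by (rule convergentI)
  then show ?thesis
    by (simp add: convergent_Suc_iff[of "\<lambda>k. Lprox k"])
qed

section \<open>Boundedness and vanishing steps\<close>

text \<open>The Cauchy loss is coercive, so its bound along the run bounds each entry of \<open>T\<close>.\<close>

lemma T_Bseq:
  assumes I: "I \<in> tidx d n"
  shows "Bseq (\<lambda>k. T k I)"
proof -
  define C where "C = Lprox (Suc 0) + Lprox_bound"
  define B where "B = sqrt (\<delta>\<^sup>2 * exp (2 * C / \<delta>\<^sup>2))"
  have "\<bar>T (k + 2) I\<bar> \<le> \<bar>A I\<bar> + B" for k
  proof -
    let ?x = "T (Suc (Suc k)) I - A I"
    have "\<delta>\<^sup>2 / 2 * ln (1 + ?x\<^sup>2 / \<delta>\<^sup>2)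
        \<le> (\<Sum>I\<in>tidx d n. \<delta>\<^sup>2 / 2 * ln (1 + (T (Suc (Suc k)) I - A I)\<^sup>2 / \<delta>\<^sup>2))"
      using I by (intro member_le_sum[of I "tidx d n" "\<lambda>I. \<delta>\<^sup>2 / 2 * ln (1 + (T (Suc (Suc k)) I - A I)\<^sup>2 / \<delta>\<^sup>2)"]
          loss_entry_nonneg) auto
    also have "\<dots> \<le> C"
      using cauchy_loss_le_Lprox[of k] decseqD[OF Lprox_decseq, of 0 k] by (simp add: C_def)
    finally have "ln (1 + ?x\<^sup>2 / \<delta>\<^sup>2) \<le> 2 * C / \<delta>\<^sup>2"
      using delta_pos by (simp add: field_simps)
    then have "exp (ln (1 + ?x\<^sup>2 / \<delta>\<^sup>2)) \<le> exp (2 * C / \<delta>\<^sup>2)"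
      by (simp only: exp_le_cancel_iff)
    moreover have "1 + ?x\<^sup>2 / \<delta>\<^sup>2 > 0"
      by (simp add: add_pos_nonneg)
    ultimately have "1 + ?x\<^sup>2 / \<delta>\<^sup>2 \<le> exp (2 * C / \<delta>\<^sup>2)"
      by (simp only: exp_ln)
    then have "?x\<^sup>2 / \<delta>\<^sup>2 \<le> exp (2 * C / \<delta>\<^sup>2)"
      by simp
    then have "?x\<^sup>2 \<le> \<delta>\<^sup>2 * exp (2 * C / \<delta>\<^sup>2)"
      using delta_pos by (simp add: field_simps)
    then have "\<bar>?x\<bar> \<le> B"
      unfolding B_def by (intro real_le_rsqrt) simp
    then show ?thesis
      by simp
  qed
  then have "Bseq (\<lambda>k. T (k + 2) I)"
    by (intro BseqI') simp
  then show ?thesis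
    by (rule Bseq_offset)
qed

lemma Y_Bseq:
  assumes I: "I \<in> tidx d n"
  shows "Bseq (\<lambda>k. Y k I)"
proof -
  from T_Bseq[OF I] obtain B where B: "\<And>k. \<bar>T k I\<bar> \<le> B"
    by (auto simp: Bseq_def)
  have "\<bar>Y (k + 2) I\<bar> \<le> B + \<bar>A I\<bar>" for k
    using Y_le[OF I, of k] B[of "Suc (Suc k)"] by simp
  then have "Bseq (\<lambda>k. Y (k + 2) I)"
    by (intro BseqI') simp
  then show ?thesis
    by (rule Bseq_offset)
qed

lemma W_Bseq:
  assumes I: "I \<in> tidx d n"
  shows "Bseq (\<lambda>k. W k I)"
proof -
  have "norm (W (k + 1) I) \<le> 1" for k
    using W_pos[OF I, of k] W_le_1[OF I, of k] by simp
  then have "Bseq (\<lambda>k. W (k + 1) I)"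
    by (rule BseqI')
  then show ?thesis
    by (rule Bseq_offset)
qed

lemma sigma_Bseq:
  assumes i: "i \<in> {1..R}"
  shows "Bseq (\<lambda>k. \<sigma> k i)"
proof -
  have "Bseq (\<lambda>k. r1 (U k) i I)" if "I \<in> tidx d n" for I
    using r1_entry_le_1[OF feasible_run i that] by (intro BseqI'[of _ 1]) simp
  then have "Bseq (\<lambda>k. \<Sum>I\<in>tidx d n. (Y k I + \<tau> * T k I) * r1 (U k) i I)"
    by (intro Bseq_sum Bseq_mult Bseq_plus Bseq_cmult_iff[THEN iffD2])
      (use tau_pos T_Bseq Y_Bseq in auto)
  then have "Bseq (\<lambda>k. (1 / \<tau>) * tinner d n (\<lambda>I. Y k I + \<tau> * T k I) (r1 (U k) i))"
    unfolding tinner_def using tau_pos by (subst Bseq_cmult_iff) auto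
  then have "Bseq (\<lambda>k. \<sigma> (Suc k) i)"
    using sigma_eq[OF i] by (simp add: Bseq_Suc_iff[of "\<lambda>k. tinner d n (\<lambda>I. Y k I + \<tau> * T k I) (r1 (U k) i) / \<tau>"])
  then show ?thesis
    by (simp add: Bseq_Suc_iff[of "\<lambda>k. \<sigma> k i"])
qed

lemma mnorm_U:
  assumes "j \<in> {1..d}"
  shows "mnorm (n j) R (U k j) = sqrt (real R)"
proof -
  have "minner (n j) R (U k j) (U k j) = (\<Sum>i\<in>{1..R}. 1)"
    unfolding minner_vinner
    by (rule sum.cong[OF refl]) (rule feasible_unit[OF feasible_run assms])
  then show ?thesis
    by (simp add: mnorm_def)
qed

lemma iterates_bounded:
  "\<exists>B. \<forall>k. vnorm R (\<sigma> k) \<le> B \<and> (\<forall>j\<in>{1..d}. mnorm (n j) R (U k j) \<le> B) \<and>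
       tnorm d n (T k) \<le> B \<and> tnorm d n (Y k) \<le> B \<and> tnorm d n (W k) \<le> B"
proof -
  have "Bseq (\<lambda>k. vnorm R (\<sigma> k))"
    unfolding vnorm_def by (rule Bseq_L2_set[OF finite_atLeastAtMost sigma_Bseq])
  then obtain Bs where Bs: "\<And>k. \<bar>vnorm R (\<sigma> k)\<bar> \<le> Bs"
    unfolding Bseq_def real_norm_def by blast
  have "Bseq (\<lambda>k. tnorm d n (T k))"
    unfolding tnorm_L2_set by (rule Bseq_L2_set[OF finite_tidx T_Bseq])
  then obtain BT where BT: "\<And>k. \<bar>tnorm d n (T k)\<bar> \<le> BT"
    unfolding Bseq_def real_norm_def by blast
  have "Bseq (\<lambda>k. tnorm d n (Y k))"
    unfolding tnorm_L2_set by (rule Bseq_L2_set[OF finite_tidx Y_Bseq])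
  then obtain BY where BY: "\<And>k. \<bar>tnorm d n (Y k)\<bar> \<le> BY"
    unfolding Bseq_def real_norm_def by blast
  have "Bseq (\<lambda>k. tnorm d n (W k))"
    unfolding tnorm_L2_set by (rule Bseq_L2_set[OF finite_tidx W_Bseq])
  then obtain BW where BW: "\<And>k. \<bar>tnorm d n (W k)\<bar> \<le> BW"
    unfolding Bseq_def real_norm_def by blast
  let ?B = "max (sqrt (real R)) (max (max Bs BT) (max BY BW))"
  have "vnorm R (\<sigma> k) \<le> ?B" "tnorm d n (T k) \<le> ?B" "tnorm d n (Y k) \<le> ?B" "tnorm d n (W k) \<le> ?B" for k
    using Bs[of k] BT[of k] BY[of k] BW[of k] by (simp_all add: le_max_iff_disj abs_le_iff)
  then show ?thesis
    by (intro exI[of _ ?B]) (simp add: mnorm_U)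
qed

lemma steps_summable: "summable (\<lambda>k. step_U (Suc k) + step_T (Suc k) + step_sigma (Suc k))"
proof -
  have "summable (\<lambda>k. step_U (Suc (Suc k)) + step_T (Suc (Suc k)) + step_sigma (Suc (Suc k)))"
  proof (rule summable_if_le_decrease[OF rate_pos])
    show "0 \<le> step_U (Suc (Suc k)) + step_T (Suc (Suc k)) + step_sigma (Suc (Suc k))" for k
      by (simp add: step_nonneg)
    show "Lprox (Suc (Suc k)) + rate * (step_U (Suc (Suc k)) + step_T (Suc (Suc k)) + step_sigma (Suc (Suc k)))
        \<le> Lprox (Suc k)" for k
      by (rule Lprox_descent)
    show "convergent (\<lambda>k. Lprox (Suc k))"
      using Lprox_convergent by (simp add: convergent_Suc_iff[of "\<lambda>k. Lprox k"])
  qed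
  then show ?thesis
    by (simp add: summable_Suc_iff[of "\<lambda>k. step_U (Suc k) + step_T (Suc k) + step_sigma (Suc k)"])
qed

lemma step_limits: "step_U \<longlonglongrightarrow> 0" "step_T \<longlonglongrightarrow> 0" "step_sigma \<longlonglongrightarrow> 0"
proof -
  have lim: "(\<lambda>k. step_U k + step_T k + step_sigma k) \<longlonglongrightarrow> 0"
    using summable_LIMSEQ_zero[OF steps_summable]
      filterlim_sequentially_Suc[of "\<lambda>k. step_U k + step_T k + step_sigma k"] by blast
  show "step_U \<longlonglongrightarrow> 0" "step_T \<longlonglongrightarrow> 0" "step_sigma \<longlonglongrightarrow> 0"
    by (rule Lim_null_comparison[OF _ lim]; simp add: step_nonneg)+
qed

lemma step_T_summable: "summable (\<lambda>k. step_U (Suc k) + step_T (Suc k))"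
  by (rule summable_comparison_test'[OF steps_summable, where N = 0]) (simp add: step_nonneg)

lemma sigma_step: "(\<lambda>k. vnorm R (\<lambda>i. \<sigma> (Suc k) i - \<sigma> k i)) \<longlonglongrightarrow> 0"
  using step_limits(3) unfolding step_sigma_def[abs_def] by (rule null_if_power2_null)

lemma sigma_diff_null: "i \<in> {1..R} \<Longrightarrow> (\<lambda>k. \<sigma> (Suc k) i - \<sigma> k i) \<longlonglongrightarrow> 0"
  using sigma_step unfolding vnorm_def by (subst (asm) L2_set_tendsto_zero_iff) auto

lemma T_diff_null:
  assumes "I \<in> tidx d n"
  shows "(\<lambda>k. T (Suc k) I - T k I) \<longlonglongrightarrow> 0"
proof -
  have "(\<lambda>k. tnorm d n (\<lambda>I. T (Suc k) I - T k I)) \<longlonglongrightarrow> 0"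
    using step_limits(2) unfolding step_T_def[abs_def] by (rule null_if_power2_null)
  then show ?thesis
    using assms unfolding tnorm_L2_set by (subst (asm) L2_set_tendsto_zero_iff) auto
qed

lemma U_diff_null:
  assumes j: "j \<in> {1..d}" and "i \<in> {1..R}" "p \<in> {1..n j}"
  shows "(\<lambda>k. U (Suc k) j i p - U k j i p) \<longlonglongrightarrow> 0"
proof -
  have "(\<lambda>k. (mnorm (n j) R (\<lambda>i p. U (Suc k) j i p - U k j i p))\<^sup>2) \<longlonglongrightarrow> 0"
  proof (rule Lim_null_comparison[OF _ step_limits(1)])
    show "\<forall>\<^sub>F k in sequentially. norm ((mnorm (n j) R (\<lambda>i p. U (Suc k) j i p - U k j i p))\<^sup>2) \<le> step_U k"
      unfolding step_U_def
      using member_le_sum[OF j, of "\<lambda>j. (mnorm (n j) R (\<lambda>i p. U (Suc _) j i p - U _ j i p))\<^sup>2"]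
      by simp
  qed
  then have "(\<lambda>k. mnorm (n j) R (\<lambda>i p. U (Suc k) j i p - U k j i p)) \<longlonglongrightarrow> 0"
    by (rule null_if_power2_null)
  then show ?thesis
    using assms unfolding mnorm_L2_set by (subst (asm) L2_set_tendsto_zero_iff) auto
qed

lemma Y_diff_null:
  assumes I: "I \<in> tidx d n"
  shows "(\<lambda>k. Y (Suc k) I - Y k I) \<longlonglongrightarrow> 0"
proof -
  have T1: "(\<lambda>k. \<bar>T (Suc (k + l)) I - T (k + l) I\<bar>) \<longlonglongrightarrow> 0" for l
    using LIMSEQ_ignore_initial_segment[OF T_diff_null[OF I], of l] by (rule tendsto_rabs_zero)
  have "(\<lambda>k. Y (Suc (k + 2)) I - Y (k + 2) I) \<longlonglongrightarrow> 0"
    by (rule Lim_null_comparison[OF _ tendsto_add_zero[OF T1[of 2] T1[of 1]]])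
      (use Y_diff_le[OF I] in simp)
  then show ?thesis
    by (rule LIMSEQ_offset)
qed

lemma W_diff_null:
  assumes I: "I \<in> tidx d n"
  shows "(\<lambda>k. W (Suc k) I - W k I) \<longlonglongrightarrow> 0"
proof -
  have "(\<lambda>k. \<bar>T (Suc (k + 1)) I - T (k + 1) I\<bar> / \<delta>) \<longlonglongrightarrow> 0"
    using LIMSEQ_ignore_initial_segment[OF T_diff_null[OF I], of 1]
    by (intro tendsto_divide_zero tendsto_rabs_zero)
  then have "(\<lambda>k. W (Suc (k + 1)) I - W (k + 1) I) \<longlonglongrightarrow> 0"
    by (rule Lim_null_comparison[rotated]) (use W_diff_le[OF I] in simp)
  then show ?thesis
    by (rule LIMSEQ_offset)
qed

text \<open>The dual step measures the residual at \<open>(\<sigma>\<^sup>k, U\<^sup>k\<^sup>+\<^sup>1)\<close>; replacing \<open>\<sigma>\<^sup>k\<close> by \<open>\<sigma>\<^sup>k\<^sup>+\<^sup>1\<close> changes it by a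
  vanishing amount.\<close>

lemma residual_null:
  assumes I: "I \<in> tidx d n"
  shows "(\<lambda>k. cp d R (\<sigma> k) (U k) I - T k I) \<longlonglongrightarrow> 0"
proof -
  have "(\<lambda>k. (\<sigma> (Suc k) i - \<sigma> k i) * r1 (U (Suc k)) i I) \<longlonglongrightarrow> 0" if i: "i \<in> {1..R}" for i
  proof (rule Lim_null_comparison[OF _ tendsto_rabs_zero[OF sigma_diff_null[OF i]]])
    show "\<forall>\<^sub>F k in sequentially. norm ((\<sigma> (Suc k) i - \<sigma> k i) * r1 (U (Suc k)) i I) \<le> \<bar>\<sigma> (Suc k) i - \<sigma> k i\<bar>"
      using r1_entry_le_1[OF feasible_run i I] by (simp add: abs_mult mult_left_le)
  qed
  then have "(\<lambda>k. \<Sum>i\<in>{1..R}. (\<sigma> (Suc k) i - \<sigma> k i) * r1 (U (Suc k)) i I) \<longlonglongrightarrow> 0"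
    by (rule tendsto_null_sum)
  then have "(\<lambda>k. (\<Sum>i\<in>{1..R}. (\<sigma> (Suc k) i - \<sigma> k i) * r1 (U (Suc k)) i I)
      - (Y (Suc k) I - Y k I) / \<tau>) \<longlonglongrightarrow> 0 - 0 / \<tau>"
    using Y_diff_null[OF I] tau_pos by (intro tendsto_intros) auto
  moreover have "(\<Sum>i\<in>{1..R}. (\<sigma> (Suc k) i - \<sigma> k i) * r1 (U (Suc k)) i I) - (Y (Suc k) I - Y k I) / \<tau>
      = cp d R (\<sigma> (Suc k)) (U (Suc k)) I - T (Suc k) I" for k
  proof -
    have "(Y (Suc k) I - Y k I) / \<tau> = - (cp d R (\<sigma> k) (U (Suc k)) I - T (Suc k) I)"
      using tau_pos by (simp add: Y_step[OF I])
    then show ?thesis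
      by (simp add: cp_def left_diff_distrib sum_subtractf)
  qed
  ultimately have "(\<lambda>k. cp d R (\<sigma> (Suc k)) (U (Suc k)) I - T (Suc k) I) \<longlonglongrightarrow> 0"
    by simp
  then show ?thesis
    by (simp add: filterlim_sequentially_Suc[of "\<lambda>k. cp d R (\<sigma> k) (U k) I - T k I"])
qed

end

section \<open>Stationarity\<close>

lemma cauchy_loss_deriv:
  assumes "\<delta> > 0"
  shows "((\<lambda>x. \<delta>\<^sup>2 / 2 * ln (1 + x\<^sup>2 / \<delta>\<^sup>2)) has_real_derivative cauchy_weight \<delta> x * x) (at x)"
proof -
  have pos: "1 + x\<^sup>2 / \<delta>\<^sup>2 > 0"
    by (simp add: add_pos_nonneg)
  have eq: "\<delta>\<^sup>2 / 2 * (1 / (1 + x\<^sup>2 / \<delta>\<^sup>2) * (2 * x / \<delta>\<^sup>2)) = cauchy_weight \<delta> x * x"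
  proof -
    have "\<delta>\<^sup>2 * (1 + x\<^sup>2 / \<delta>\<^sup>2) = \<delta>\<^sup>2 + x\<^sup>2"
      using assms by (simp add: distrib_left)
    then have "cauchy_weight \<delta> x = \<delta>\<^sup>2 / (\<delta>\<^sup>2 * (1 + x\<^sup>2 / \<delta>\<^sup>2))"
      by (simp only: cauchy_weight_def)
    also have "\<dots> = 1 / (1 + x\<^sup>2 / \<delta>\<^sup>2)"
      using assms by simp
    finally show ?thesis
      using assms by simp
  qed
  have "((\<lambda>x. x\<^sup>2) has_real_derivative 2 * x) (at x)"
    by (auto intro!: derivative_eq_intros)
  from DERIV_add[OF DERIV_const DERIV_cdivide[OF this, of "\<delta>\<^sup>2"], of 1]
  have "((\<lambda>x. 1 + x\<^sup>2 / \<delta>\<^sup>2) has_real_derivative 2 * x / \<delta>\<^sup>2) (at x)"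
    by simp
  from DERIV_cmult[OF DERIV_chain2[OF DERIV_ln_divide[OF pos] this], of "\<delta>\<^sup>2 / 2"] show ?thesis
    by (simp only: eq)
qed

lemma objective_deriv:
  assumes \<delta>: "\<delta> > 0"
    and g: "\<And>I. I \<in> tidx d n \<Longrightarrow> ((\<lambda>x. cp d R (s x) (V x) I) has_real_derivative g I) (at x)"
  shows "((\<lambda>x. objective d n R \<delta> A (s x) (V x)) has_real_derivative
    - (\<Sum>I\<in>tidx d n. cauchy_weight \<delta> (A I - cp d R (s x) (V x) I) * (A I - cp d R (s x) (V x) I) * g I))
    (at x)"
proof -
  have "((\<lambda>x. \<delta>\<^sup>2 / 2 * ln (1 + (A I - cp d R (s x) (V x) I)\<^sup>2 / \<delta>\<^sup>2)) has_real_derivative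
      cauchy_weight \<delta> (A I - cp d R (s x) (V x) I) * (A I - cp d R (s x) (V x) I) * (0 - g I)) (at x)"
    if "I \<in> tidx d n" for I
    using DERIV_chain2[OF cauchy_loss_deriv[OF \<delta>] DERIV_diff[OF DERIV_const g[OF that]]] .
  then have "((\<lambda>x. \<Sum>I\<in>tidx d n. \<delta>\<^sup>2 / 2 * ln (1 + (A I - cp d R (s x) (V x) I)\<^sup>2 / \<delta>\<^sup>2)) has_real_derivative
      (\<Sum>I\<in>tidx d n. cauchy_weight \<delta> (A I - cp d R (s x) (V x) I) * (A I - cp d R (s x) (V x) I) * (0 - g I)))
      (at x)"
    by (rule DERIV_sum)
  then show ?thesis
    by (simp add: objective_def cauchy_loss_def sum_distrib_left sum_negf)
qed

lemma cp_factor_deriv: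
  assumes j: "j \<in> {1..d}" and i: "i \<in> {1..R}"
  shows "((\<lambda>x. cp d R \<sigma> (U(j := (U j)(i := (U j i)(p := x)))) I) has_real_derivative
    (if I j = p then \<sigma> i * (\<Prod>l\<in>{1..d} - {j}. U l i (I l)) else 0)) (at x)"
proof -
  let ?V = "\<lambda>x. U(j := (U j)(i := (U j i)(p := x)))"
  have "rank_one d (\<lambda>l. ?V x l r) I
      = (if r = i \<and> I j = p then x * (\<Prod>l\<in>{1..d} - {j}. U l i (I l)) else rank_one d (\<lambda>l. U l r) I)" for x r
  proof -
    have "(\<Prod>l\<in>{1..d} - {j}. ?V x l r (I l)) = (\<Prod>l\<in>{1..d} - {j}. U l r (I l))"
      by (rule prod.cong) auto
    then show ?thesis
      by (simp add: rank_one_split[OF j])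
  qed
  then have "((\<lambda>x. \<sigma> r * rank_one d (\<lambda>l. ?V x l r) I) has_real_derivative
      (if r = i then (if I j = p then \<sigma> i * (\<Prod>l\<in>{1..d} - {j}. U l i (I l)) else 0) else 0)) (at x)" for r
    by (auto intro!: derivative_eq_intros)
  then have "((\<lambda>x. cp d R \<sigma> (?V x) I) has_real_derivative
      (\<Sum>r\<in>{1..R}. if r = i then (if I j = p then \<sigma> i * (\<Prod>l\<in>{1..d} - {j}. U l i (I l)) else 0) else 0)) (at x)"
    unfolding cp_def by (intro DERIV_sum)
  then show ?thesis
    using i by simp
qed

lemma cp_coefficient_deriv:
  assumes i: "i \<in> {1..R}"
  shows "((\<lambda>x. cp d R (\<sigma>(i := x)) U I) has_real_derivative rank_one d (\<lambda>j. U j i) I) (at x)"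
proof -
  have "((\<lambda>x. (\<sigma>(i := x)) r * rank_one d (\<lambda>j. U j r) I) has_real_derivative
      (if r = i then rank_one d (\<lambda>j. U j i) I else 0)) (at x)" for r
    by (auto intro!: derivative_eq_intros)
  then have "((\<lambda>x. cp d R (\<sigma>(i := x)) U I) has_real_derivative
      (\<Sum>r\<in>{1..R}. if r = i then rank_one d (\<lambda>j. U j i) I else 0)) (at x)"
    unfolding cp_def by (intro DERIV_sum)
  then show ?thesis
    using i by simp
qed

lemma contract_cong_tensor:
  "(\<And>I. I \<in> tidx d n \<Longrightarrow> X I = X' I) \<Longrightarrow> contract d n X u j p = contract d n X' u j p"
  by (simp add: contract_def)

lemma objective_factor_deriv:
  assumes "\<delta> > 0" and j: "j \<in> {1..d}" and i: "i \<in> {1..R}"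
    and Y: "\<And>I. I \<in> tidx d n \<Longrightarrow>
      Y I = cauchy_weight \<delta> (A I - cp d R \<sigma> U I) * (A I - cp d R \<sigma> U I)"
  shows "((\<lambda>x. objective d n R \<delta> A \<sigma> (U(j := (U j)(i := (U j i)(p := x))))) has_real_derivative
    - (\<sigma> i * contract d n Y (\<lambda>l. U l i) j p)) (at (U j i p))"
proof -
  have U: "U(j := (U j)(i := (U j i)(p := U j i p))) = U"
    by simp
  have "(\<Sum>I\<in>tidx d n. cauchy_weight \<delta> (A I - cp d R \<sigma> U I) * (A I - cp d R \<sigma> U I)
        * (if I j = p then \<sigma> i * (\<Prod>l\<in>{1..d} - {j}. U l i (I l)) else 0))
      = (\<Sum>I\<in>tidx d n. if I j = p then \<sigma> i * (Y I * (\<Prod>l\<in>{1..d} - {j}. U l i (I l))) else 0)"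
    by (rule sum.cong) (simp_all add: Y)
  also have "\<dots> = \<sigma> i * contract d n Y (\<lambda>l. U l i) j p"
    unfolding contract_def sum_distrib_left by (rule sum.inter_filter[symmetric]) simp
  finally show ?thesis
    using objective_deriv[OF assms(1) cp_factor_deriv[OF j i], of n A \<sigma> U p "U j i p"] by (simp only: U)
qed

lemma objective_coefficient_deriv:
  assumes "\<delta> > 0" and i: "i \<in> {1..R}"
    and Y: "\<And>I. I \<in> tidx d n \<Longrightarrow>
      Y I = cauchy_weight \<delta> (A I - cp d R \<sigma> U I) * (A I - cp d R \<sigma> U I)"
  shows "((\<lambda>x. objective d n R \<delta> A (\<sigma>(i := x)) U) has_real_derivative
    - tinner d n Y (rank_one d (\<lambda>j. U j i))) (at (\<sigma> i))"
proof -
  have "(\<Sum>I\<in>tidx d n. cauchy_weight \<delta> (A I - cp d R \<sigma> U I) * (A I - cp d R \<sigma> U I)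
        * rank_one d (\<lambda>j. U j i) I) = tinner d n Y (rank_one d (\<lambda>j. U j i))"
    unfolding tinner_def by (rule sum.cong) (simp_all add: Y)
  then show ?thesis
    using objective_deriv[where s = "\<lambda>x. \<sigma>(i := x)" and V = "\<lambda>_. U" and d = d and n = n and A = A
        and x = "\<sigma> i", OF assms(1) cp_coefficient_deriv[OF i]]
    by (simp only: fun_upd_triv)
qed

text \<open>By the feasibility equation \<open>cp \<sigma> U = T\<close> the contraction of \<open>Y + \<tau> T\<close> splits into that of
  \<open>Y\<close>, which carries the gradient of the objective, and that of the approximation itself.  In a
  normalised mode orthonormality reduces the latter to \<open>\<sigma> i * u\<close>, which cancels the multiplier
  exactly, so \<open>\<eta> = 0\<close>; in an orthonormal mode it is a symmetric combination of the columns.\<close>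

lemma (in cp_problem) stationary_pointI:
  assumes \<delta>: "\<delta> > 0" and U: "feasible d n R t U"
    and cpT: "\<And>I. I \<in> tidx d n \<Longrightarrow> cp d R \<sigma> U I = T I"
    and Y: "\<And>I. I \<in> tidx d n \<Longrightarrow> Y I = cauchy_weight \<delta> (A I - T I) * (A I - T I)"
    and coeff: "\<And>i. i \<in> {1..R} \<Longrightarrow> tinner d n (\<lambda>I. Y I + \<tau> * T I) (r1 U i) = \<tau> * \<sigma> i"
    and unit: "\<And>j i p. j \<in> {1..d - t} \<Longrightarrow> i \<in> {1..R} \<Longrightarrow> p \<in> {1..n j} \<Longrightarrow>
      \<sigma> i * contract d n (\<lambda>I. Y I + \<tau> * T I) (\<lambda>l. U l i) j p = \<tau> * (\<sigma> i)\<^sup>2 * U j i p"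
    and sym: "\<And>j i r. j \<in> {d - t + 1..d} \<Longrightarrow> i \<in> {1..R} \<Longrightarrow> r \<in> {1..R} \<Longrightarrow> \<Lambda> j i r = \<Lambda> j r i"
    and orth: "\<And>j i p. j \<in> {d - t + 1..d} \<Longrightarrow> i \<in> {1..R} \<Longrightarrow> p \<in> {1..n j} \<Longrightarrow>
      \<sigma> i * contract d n (\<lambda>I. Y I + \<tau> * T I) (\<lambda>l. U l i) j p = (\<Sum>r\<in>{1..R}. \<Lambda> j i r * U j r p)"
  shows "stationary_point d n R t \<delta> A \<sigma> U"
proof -
  define M where "M j i r = \<tau> * \<sigma> i * \<sigma> r * (\<Prod>l\<in>{1..d} - {j}. vinner (n l) (U l r) (U l i)) - \<Lambda> j i r"
    for j i r
  have Y': "Y I = cauchy_weight \<delta> (A I - cp d R \<sigma> U I) * (A I - cp d R \<sigma> U I)" if "I \<in> tidx d n" for I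
    using that by (simp add: Y cpT)
  have split: "\<sigma> i * contract d n Y (\<lambda>l. U l i) j p
      = \<sigma> i * contract d n (\<lambda>I. Y I + \<tau> * T I) (\<lambda>l. U l i) j p
        - \<tau> * \<sigma> i * (\<Sum>r\<in>{1..R}. \<sigma> r * (U j r p * (\<Prod>l\<in>{1..d} - {j}. vinner (n l) (U l r) (U l i))))"
    if "j \<in> {1..d}" "p \<in> {1..n j}" for i j p
  proof -
    have "contract d n T (\<lambda>l. U l i) j p
        = (\<Sum>r\<in>{1..R}. \<sigma> r * (U j r p * (\<Prod>l\<in>{1..d} - {j}. vinner (n l) (U l r) (U l i))))"
      using contract_cp[of j d p n R \<sigma> U "\<lambda>l. U l i"] that
        contract_cong_tensor[of d n "cp d R \<sigma> U" T "\<lambda>l. U l i" j p] cpT by simp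
    then show ?thesis
      by (simp add: contract_add algebra_simps)
  qed
  have unit0: "- (\<sigma> i * contract d n Y (\<lambda>l. U l i) j p) = 0 * U j i p"
    if j: "j \<in> {1..d - t}" and i: "i \<in> {1..R}" and p: "p \<in> {1..n j}" for j i p
  proof -
    have dj: "d \<in> {1..d} - {j}"
      using last_mode j by auto
    have "(\<Sum>r\<in>{1..R}. \<sigma> r * (U j r p * (\<Prod>l\<in>{1..d} - {j}. vinner (n l) (U l r) (U l i))))
        = (\<Sum>r\<in>{1..R}. \<sigma> r * (U j r p * (if r = i then 1 else 0)))"
      using prod_vinner_feasible[OF U Diff_subset dj _ i] by simp
    also have "\<dots> = \<sigma> i * U j i p"
      using i by (simp add: if_distrib cong: if_cong)
    finally show ?thesis
      using split[OF modes_in(1)[OF j] p, of i] unit[OF j i p] by (simp add: power2_eq_square)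
  qed
  have orth0: "- (\<sigma> i * contract d n Y (\<lambda>l. U l i) j p) = (\<Sum>r\<in>{1..R}. M j i r * U j r p)"
    if j: "j \<in> {d - t + 1..d}" and i: "i \<in> {1..R}" and p: "p \<in> {1..n j}" for j i p
    using split[OF modes_in(2)[OF j] p, of i] orth[OF j i p]
    by (simp add: M_def algebra_simps sum_subtractf sum_distrib_left)
  have coeff0: "- tinner d n Y (r1 U i) = 0" if i: "i \<in> {1..R}" for i
  proof -
    have "tinner d n T (r1 U i) = \<sigma> i"
      using tinner_cp_r1[OF U i, of \<sigma>] tinner_cong[of d n "cp d R \<sigma> U" T "r1 U i" "r1 U i"] cpT by simp
    then show ?thesis
      using coeff[OF i] by (simp add: tinner_add_left)
  qed
  show ?thesis
    unfolding stationary_point_def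
  proof (intro conjI exI ballI)
    show "feasible d n R t U"
      by (fact U)
    show "M j i r = M j r i" if "j \<in> {d - t + 1..d}" "i \<in> {1..R}" "r \<in> {1..R}" for j i r
      using sym[OF that] by (simp add: M_def vinner_commute)
    show "((\<lambda>x. objective d n R \<delta> A \<sigma> (U(j := (U j)(i := (U j i)(p := x))))) has_real_derivative
        0 * U j i p) (at (U j i p))"
      if "j \<in> {1..d - t}" "i \<in> {1..R}" "p \<in> {1..n j}" for j i p
      unfolding unit0[OF that, symmetric]
      by (rule objective_factor_deriv[OF \<delta> modes_in(1)[OF that(1)] that(2) Y'])
    show "((\<lambda>x. objective d n R \<delta> A \<sigma> (U(j := (U j)(i := (U j i)(p := x))))) has_real_derivative
        (\<Sum>r\<in>{1..R}. M j i r * U j r p)) (at (U j i p))"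
      if "j \<in> {d - t + 1..d}" "i \<in> {1..R}" "p \<in> {1..n j}" for j i p
      unfolding orth0[OF that, symmetric]
      by (rule objective_factor_deriv[OF \<delta> modes_in(2)[OF that(1)] that(2) Y'])
    show "((\<lambda>x. objective d n R \<delta> A (\<sigma>(i := x)) U) has_real_derivative 0) (at (\<sigma> i))"
      if "i \<in> {1..R}" for i
      unfolding coeff0[OF that, symmetric]
      by (rule objective_coefficient_deriv[OF \<delta> that Y'])
  qed
qed

section \<open>Limit points\<close>

lemma vinner_orthonormal_combination:
  assumes P: "orthonormal_cols m R P"
  shows "vinner m (\<lambda>p. \<Sum>a\<in>{1..R}. x a * P a p) (\<lambda>p. \<Sum>b\<in>{1..R}. y b * P b p) = (\<Sum>a\<in>{1..R}. x a * y a)"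
proof -
  have "vinner m (\<lambda>p. \<Sum>a\<in>{1..R}. x a * P a p) (\<lambda>p. \<Sum>b\<in>{1..R}. y b * P b p)
      = (\<Sum>p\<in>{1..m}. \<Sum>a\<in>{1..R}. \<Sum>b\<in>{1..R}. x a * (y b * (P a p * P b p)))"
    by (simp add: vinner_def sum_product mult_ac)
  also have "\<dots> = (\<Sum>a\<in>{1..R}. \<Sum>p\<in>{1..m}. \<Sum>b\<in>{1..R}. x a * (y b * (P a p * P b p)))"
    by (rule sum.swap)
  also have "\<dots> = (\<Sum>a\<in>{1..R}. \<Sum>b\<in>{1..R}. \<Sum>p\<in>{1..m}. x a * (y b * (P a p * P b p)))"
    by (intro sum.cong refl sum.swap)
  also have "\<dots> = (\<Sum>a\<in>{1..R}. \<Sum>b\<in>{1..R}. x a * (y b * vinner m (P a) (P b)))"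
    by (simp add: vinner_def sum_distrib_left)
  also have "\<dots> = (\<Sum>a\<in>{1..R}. \<Sum>b\<in>{1..R}. x a * (y b * (if a = b then 1 else 0)))"
    using P unfolding orthonormal_cols_vinner by (intro sum.cong refl) simp
  also have "\<dots> = (\<Sum>a\<in>{1..R}. x a * y a)"
    by (intro sum.cong refl) (simp add: if_distrib cong: if_cong)
  finally show ?thesis .
qed

text \<open>The polar factor \<open>M = P Q\<^sup>T\<close> of \<open>V = P \<Xi> Q\<^sup>T\<close> satisfies \<open>V = M (Q \<Xi> Q\<^sup>T)\<close>, and the symmetric matrix
  \<open>Q \<Xi> Q\<^sup>T\<close> equals \<open>V\<^sup>T M\<close>.  The latter form is continuous in \<open>V\<close> and \<open>M\<close>, so that these relations pass
  to the limit although the singular vectors need not converge.\<close>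

lemma polar_factor:
  assumes svd: "is_svd m R V P \<xi> Q"
    and M: "\<And>i p. i \<in> {1..R} \<Longrightarrow> p \<in> {1..m} \<Longrightarrow> M i p = (\<Sum>r\<in>{1..R}. P r p * Q r i)"
  shows "i \<in> {1..R} \<Longrightarrow> r \<in> {1..R} \<Longrightarrow> vinner m (V i) (M r) = vinner m (V r) (M i)"
    and "i \<in> {1..R} \<Longrightarrow> p \<in> {1..m} \<Longrightarrow> V i p = (\<Sum>r\<in>{1..R}. vinner m (V i) (M r) * M r p)"
proof -
  have P: "orthonormal_cols m R P" and Q: "orthonormal_cols R R Q"
    and V: "\<And>i p. i \<in> {1..R} \<Longrightarrow> p \<in> {1..m} \<Longrightarrow> V i p = (\<Sum>r\<in>{1..R}. P r p * \<xi> r * Q r i)"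
    using svd by (auto simp: is_svd_def)
  have H: "vinner m (V i) (M r) = (\<Sum>a\<in>{1..R}. (\<xi> a * Q a i) * Q a r)"
    if "i \<in> {1..R}" "r \<in> {1..R}" for i r
  proof -
    have "vinner m (V i) (M r)
        = vinner m (\<lambda>p. \<Sum>a\<in>{1..R}. (\<xi> a * Q a i) * P a p) (\<lambda>p. \<Sum>b\<in>{1..R}. Q b r * P b p)"
      using that by (intro vinner_cong) (simp_all add: V M mult_ac)
    then show ?thesis
      by (simp only: vinner_orthonormal_combination[OF P])
  qed
  show "vinner m (V i) (M r) = vinner m (V r) (M i)" if "i \<in> {1..R}" "r \<in> {1..R}"
    using that by (simp add: H mult_ac)
  show "V i p = (\<Sum>r\<in>{1..R}. vinner m (V i) (M r) * M r p)" if i: "i \<in> {1..R}" and p: "p \<in> {1..m}"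
  proof -
    have "(\<Sum>r\<in>{1..R}. vinner m (V i) (M r) * M r p)
        = vinner R (\<lambda>r. \<Sum>a\<in>{1..R}. (\<xi> a * Q a i) * Q a r) (\<lambda>r. \<Sum>b\<in>{1..R}. P b p * Q b r)"
      unfolding vinner_def[of R] using i p by (intro sum.cong refl) (simp add: H M)
    also have "\<dots> = (\<Sum>a\<in>{1..R}. (\<xi> a * Q a i) * P a p)"
      by (rule vinner_orthonormal_combination[OF Q])
    finally show ?thesis
      using i p by (simp add: V mult_ac)
  qed
qed

text \<open>A limit point in coordinates: all the norms in its definition are Euclidean norms over finite
  index sets, so convergence along \<open>s\<close> means convergence of every entry.\<close>

locale hq_admm_limit = hq_admm_run +
  fixes s :: "nat \<Rightarrow> nat" and \<sigma>' :: rvec and U' :: factors and T' Y' W' :: tensor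
  assumes mono: "strict_mono s"
    and sigma_lim: "\<And>i. i \<in> {1..R} \<Longrightarrow> (\<lambda>k. \<sigma> (s k) i) \<longlonglongrightarrow> \<sigma>' i"
    and U_lim: "\<And>j i p. j \<in> {1..d} \<Longrightarrow> i \<in> {1..R} \<Longrightarrow> p \<in> {1..n j} \<Longrightarrow> (\<lambda>k. U (s k) j i p) \<longlonglongrightarrow> U' j i p"
    and T_lim: "\<And>I. I \<in> tidx d n \<Longrightarrow> (\<lambda>k. T (s k) I) \<longlonglongrightarrow> T' I"
    and Y_lim: "\<And>I. I \<in> tidx d n \<Longrightarrow> (\<lambda>k. Y (s k) I) \<longlonglongrightarrow> Y' I"
    and W_lim: "\<And>I. I \<in> tidx d n \<Longrightarrow> (\<lambda>k. W (s k) I) \<longlonglongrightarrow> W' I"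
begin

text \<open>Since steps vanish, the next iterates have the same limits; each update rule, which links two
  consecutive iterates, therefore turns into an equation for the limit point.\<close>

lemma shifted_limit:
  fixes x :: "nat \<Rightarrow> real"
  assumes "(\<lambda>k. x (s k)) \<longlonglongrightarrow> l" "(\<lambda>k. x (Suc k) - x k) \<longlonglongrightarrow> 0"
  shows "(\<lambda>k. x (Suc (s k))) \<longlonglongrightarrow> l"
proof -
  have "(\<lambda>k. x (Suc (s k)) - x (s k)) \<longlonglongrightarrow> 0"
    using LIMSEQ_subseq_LIMSEQ[OF assms(2) mono] by (simp add: o_def)
  from tendsto_add[OF this assms(1)] show ?thesis
    by simp
qed

lemma sigma_lim_Suc: "i \<in> {1..R} \<Longrightarrow> (\<lambda>k. \<sigma> (Suc (s k)) i) \<longlonglongrightarrow> \<sigma>' i"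
  by (rule shifted_limit[OF sigma_lim sigma_diff_null])

lemma U_lim_Suc:
  "j \<in> {1..d} \<Longrightarrow> i \<in> {1..R} \<Longrightarrow> p \<in> {1..n j} \<Longrightarrow> (\<lambda>k. U (Suc (s k)) j i p) \<longlonglongrightarrow> U' j i p"
  by (rule shifted_limit[OF U_lim U_diff_null])

lemma tensor_lim_Suc:
  assumes "I \<in> tidx d n"
  shows T_lim_Suc: "(\<lambda>k. T (Suc (s k)) I) \<longlonglongrightarrow> T' I"
    and Y_lim_Suc: "(\<lambda>k. Y (Suc (s k)) I) \<longlonglongrightarrow> Y' I"
    and W_lim_Suc: "(\<lambda>k. W (Suc (s k)) I) \<longlonglongrightarrow> W' I"
  by (rule shifted_limit[OF T_lim[OF assms] T_diff_null[OF assms]]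
      shifted_limit[OF Y_lim[OF assms] Y_diff_null[OF assms]]
      shifted_limit[OF W_lim[OF assms] W_diff_null[OF assms]])+

lemma vinner_tendsto:
  assumes "\<And>p. p \<in> {1..m} \<Longrightarrow> (\<lambda>k. v k p) \<longlonglongrightarrow> v' p" "\<And>p. p \<in> {1..m} \<Longrightarrow> (\<lambda>k. w k p) \<longlonglongrightarrow> w' p"
  shows "(\<lambda>k. vinner m (v k) (w k)) \<longlonglongrightarrow> vinner m v' w'"
  unfolding vinner_def by (intro tendsto_sum tendsto_mult assms)

lemma r1_tendsto:
  assumes "i \<in> {1..R}" "I \<in> tidx d n"
    and "\<And>j p. j \<in> {1..d} \<Longrightarrow> p \<in> {1..n j} \<Longrightarrow> (\<lambda>k. V k j i p) \<longlonglongrightarrow> V' j i p"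
  shows "(\<lambda>k. r1 (V k) i I) \<longlonglongrightarrow> r1 V' i I"
  unfolding rank_one_def by (intro tendsto_prod assms(3) tidx_in[OF assms(2)])

lemma cp_limit:
  assumes I: "I \<in> tidx d n"
  shows "cp d R \<sigma>' U' I = T' I"
proof -
  have "(\<lambda>k. cp d R (\<sigma> (s k)) (U (s k)) I - T (s k) I) \<longlonglongrightarrow> cp d R \<sigma>' U' I - T' I"
    unfolding cp_def
    by (intro tendsto_diff tendsto_sum tendsto_mult sigma_lim r1_tendsto U_lim T_lim I)
  moreover have "(\<lambda>k. cp d R (\<sigma> (s k)) (U (s k)) I - T (s k) I) \<longlonglongrightarrow> 0"
    using LIMSEQ_subseq_LIMSEQ[OF residual_null[OF I] mono] by (simp add: o_def)
  ultimately show ?thesis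
    using LIMSEQ_unique by fastforce
qed

lemma weight_limit:
  assumes I: "I \<in> tidx d n"
  shows "W' I = cauchy_weight \<delta> (T' I - A I)"
proof -
  have "\<delta>\<^sup>2 + x\<^sup>2 \<noteq> 0" for x
    using delta_pos by (simp add: add_nonneg_eq_0_iff)
  then have "(\<lambda>k. cauchy_weight \<delta> (T (Suc (s k)) I - A I)) \<longlonglongrightarrow> cauchy_weight \<delta> (T' I - A I)"
    unfolding cauchy_weight_def by (intro tendsto_intros T_lim_Suc I)
  then have "(\<lambda>k. W (Suc (s k)) I) \<longlonglongrightarrow> cauchy_weight \<delta> (T' I - A I)"
    by (simp only: W_eq[OF I])
  then show ?thesis
    by (rule LIMSEQ_unique[OF W_lim_Suc[OF I]])
qed

lemma multiplier_limit:
  assumes I: "I \<in> tidx d n"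
  shows "Y' I = W' I * (A I - T' I)"
proof -
  have "(\<lambda>k. W (s k) I * (A I - T (Suc (s k)) I)) \<longlonglongrightarrow> W' I * (A I - T' I)"
    by (intro tendsto_intros W_lim T_lim_Suc I)
  then have "(\<lambda>k. Y (Suc (s k)) I) \<longlonglongrightarrow> W' I * (A I - T' I)"
    by (simp only: Y_eq[OF I])
  then show ?thesis
    by (rule LIMSEQ_unique[OF Y_lim_Suc[OF I]])
qed

lemma vinner_U_limit:
  assumes "j \<in> {1..d}" "i \<in> {1..R}" "r \<in> {1..R}" and "\<And>k. vinner (n j) (U k j i) (U k j r) = c"
  shows "vinner (n j) (U' j i) (U' j r) = c"
proof -
  have "(\<lambda>k. vinner (n j) (U (s k) j i) (U (s k) j r)) \<longlonglongrightarrow> vinner (n j) (U' j i) (U' j r)"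
    by (intro vinner_tendsto U_lim assms)
  then show ?thesis
    using assms(4) by (simp add: LIMSEQ_const_iff)
qed

lemma feasible_limit: "feasible d n R t U'"
  unfolding feasible_def orthonormal_cols_vinner
proof (intro conjI ballI)
  show "vnorm (n j) (U' j i) = 1" if "j \<in> {1..d - t}" "i \<in> {1..R}" for j i
    using vinner_U_limit[OF modes_in(1)[OF that(1)] that(2,2)]
      feasible_unit[OF feasible_run modes_in(1)[OF that(1)] that(2)]
    by (simp add: vnorm_eq_sqrt)
  show "vinner (n j) (U' j i) (U' j r) = (if i = r then 1 else 0)"
    if "j \<in> {d - t + 1..d}" "i \<in> {1..R}" "r \<in> {1..R}" for j i r
    using vinner_U_limit[OF modes_in(2)[OF that(1)] that(2,3)] feasible_orthogonal[OF feasible_run that]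
    by blast
qed

abbreviation "X' I \<equiv> Y' I + \<tau> * T' I"

lemma coefficient_limit:
  assumes i: "i \<in> {1..R}"
  shows "tinner d n X' (r1 U' i) = \<tau> * \<sigma>' i"
proof -
  have "(\<lambda>k. tinner d n (\<lambda>I. Y (Suc (s k)) I + \<tau> * T (Suc (s k)) I) (r1 (U (Suc (s k))) i))
      \<longlonglongrightarrow> tinner d n X' (r1 U' i)"
    unfolding tinner_def
    by (intro tendsto_intros Y_lim_Suc T_lim_Suc r1_tendsto U_lim_Suc i)
  moreover have "tinner d n (\<lambda>I. Y (Suc (s k)) I + \<tau> * T (Suc (s k)) I) (r1 (U (Suc (s k))) i)
      = \<tau> * \<sigma> (Suc (s k)) i" for k
    using sigma_eq[OF i, of "s k"] tau_pos by simp
  ultimately have "(\<lambda>k. \<tau> * \<sigma> (Suc (s k)) i) \<longlonglongrightarrow> tinner d n X' (r1 U' i)"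
    by simp
  then show ?thesis
    using tendsto_mult_left[OF sigma_lim_Suc[OF i], of \<tau>] LIMSEQ_unique by blast
qed

definition "dir k = update_dir d n \<alpha> \<tau> (\<sigma> (s k)) (T (s k)) (Y (s k)) (U (s k)) (U (Suc (s k)))"

definition "dir' j i p = \<sigma>' i * contract d n X' (\<lambda>l. U' l i) j p + \<alpha> * U' j i p"

lemma dir_limit:
  assumes j: "j \<in> {1..d}" and i: "i \<in> {1..R}" and p: "p \<in> {1..n j}"
  shows "(\<lambda>k. dir k j i p) \<longlonglongrightarrow> dir' j i p"
proof -
  have "(\<lambda>k. (if l < j then U (Suc (s k)) l i else U (s k) l i) (I l)) \<longlonglongrightarrow> U' l i (I l)"
    if "I \<in> tidx d n" "l \<in> {1..d}" for I l
    using U_lim[OF that(2) i tidx_in[OF that]] U_lim_Suc[OF that(2) i tidx_in[OF that]] by (cases "l < j") auto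
  then have "(\<lambda>k. contract d n (\<lambda>I. Y (s k) I + \<tau> * T (s k) I)
        (\<lambda>l. if l < j then U (Suc (s k)) l i else U (s k) l i) j p)
      \<longlonglongrightarrow> contract d n X' (\<lambda>l. U' l i) j p"
    unfolding contract_def by (intro tendsto_intros Y_lim T_lim) auto
  then show ?thesis
    unfolding dir_def dir'_def update_dir_def
    by (intro tendsto_intros sigma_lim[OF i] U_lim[OF j i p])
qed

text \<open>In the limit the update direction is a multiple \<open>\<nu> u\<close> of the column itself; pairing with \<open>u\<close>
  identifies \<open>\<nu> - \<alpha> = \<tau> \<sigma>\<^sup>2\<close>.\<close>

lemma unit_mode_limit:
  assumes j: "j \<in> {1..d - t}" and i: "i \<in> {1..R}" and p: "p \<in> {1..n j}"
  shows "\<sigma>' i * contract d n X' (\<lambda>l. U' l i) j p = \<tau> * (\<sigma>' i)\<^sup>2 * U' j i p"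
proof -
  note j' = modes_in(1)[OF j]
  define \<nu> where "\<nu> = vnorm (n j) (dir' j i)"
  have dir': "dir' j i q = \<nu> * U' j i q" if q: "q \<in> {1..n j}" for q
  proof -
    have "(\<lambda>k. vnorm (n j) (dir k j i)) \<longlonglongrightarrow> \<nu>"
      unfolding \<nu>_def vnorm_eq_sqrt by (intro tendsto_real_sqrt vinner_tendsto dir_limit j' i)
    then have "(\<lambda>k. vnorm (n j) (dir k j i) * U (Suc (s k)) j i q) \<longlonglongrightarrow> \<nu> * U' j i q"
      by (intro tendsto_mult U_lim_Suc j' i q)
    moreover have "vnorm (n j) (dir k j i) * U (Suc (s k)) j i q = dir k j i q" for k
    proof -
      have "vnorm (n j) (dir k j i) \<noteq> 0" "U (Suc (s k)) j i q = dir k j i q / vnorm (n j) (dir k j i)"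
        using factors_step[of "s k"] j i q unfolding factor_update_def Let_def dir_def by blast+
      then show ?thesis
        by simp
    qed
    ultimately have "(\<lambda>k. dir k j i q) \<longlonglongrightarrow> \<nu> * U' j i q"
      by simp
    then show ?thesis
      by (rule LIMSEQ_unique[OF dir_limit[OF j' i q]])
  qed
  have c: "\<sigma>' i * contract d n X' (\<lambda>l. U' l i) j q = (\<nu> - \<alpha>) * U' j i q" if "q \<in> {1..n j}" for q
    using dir'[OF that] by (simp add: dir'_def algebra_simps)
  have "\<sigma>' i * (\<tau> * \<sigma>' i) = \<sigma>' i * vinner (n j) (contract d n X' (\<lambda>l. U' l i) j) (U' j i)"
    by (simp only: coefficient_limit[OF i, symmetric] tinner_rank_one_contract[OF j'])
  also have "\<dots> = (\<Sum>q\<in>{1..n j}. (\<sigma>' i * contract d n X' (\<lambda>l. U' l i) j q) * U' j i q)"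
    by (simp add: vinner_def sum_distrib_left mult.assoc)
  also have "\<dots> = (\<Sum>q\<in>{1..n j}. (\<nu> - \<alpha>) * U' j i q * U' j i q)"
    by (rule sum.cong) (simp_all only: c)
  also have "\<dots> = (\<nu> - \<alpha>) * vinner (n j) (U' j i) (U' j i)"
    by (simp only: vinner_def sum_distrib_left mult.assoc)
  finally have "\<tau> * (\<sigma>' i)\<^sup>2 = \<nu> - \<alpha>"
    by (simp add: feasible_unit[OF feasible_limit j' i] power2_eq_square mult_ac)
  then show ?thesis
    using c[OF p] by simp
qed

definition "mult' j i r = vinner (n j) (dir' j i) (U' j r) - (if i = r then \<alpha> else 0)"

lemma orthonormal_mode_limit:
  assumes j: "j \<in> {d - t + 1..d}"
  shows "i \<in> {1..R} \<Longrightarrow> r \<in> {1..R} \<Longrightarrow> mult' j i r = mult' j r i"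
    and "i \<in> {1..R} \<Longrightarrow> p \<in> {1..n j} \<Longrightarrow>
      \<sigma>' i * contract d n X' (\<lambda>l. U' l i) j p = (\<Sum>r\<in>{1..R}. mult' j i r * U' j r p)"
proof -
  note j' = modes_in(2)[OF j]
  have H_lim: "(\<lambda>k. vinner (n j) (dir k j i) (U (Suc (s k)) j r)) \<longlonglongrightarrow> vinner (n j) (dir' j i) (U' j r)"
    if "i \<in> {1..R}" "r \<in> {1..R}" for i r
    by (intro vinner_tendsto dir_limit U_lim_Suc j' that)
  have polar: "\<exists>P \<xi> Q. is_svd (n j) R (dir k j) P \<xi> Q \<and>
      (\<forall>i\<in>{1..R}. \<forall>p\<in>{1..n j}. U (Suc (s k)) j i p = (\<Sum>r\<in>{1..R}. P r p * Q r i))" for k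
    using factors_step[of "s k"] j unfolding factor_update_def Let_def dir_def by blast
  show "mult' j i r = mult' j r i" if i: "i \<in> {1..R}" and r: "r \<in> {1..R}"
  proof -
    have "vinner (n j) (dir k j i) (U (Suc (s k)) j r) = vinner (n j) (dir k j r) (U (Suc (s k)) j i)" for k
    proof -
      from polar[of k] obtain P \<xi> Q where "is_svd (n j) R (dir k j) P \<xi> Q"
        "\<And>i p. i \<in> {1..R} \<Longrightarrow> p \<in> {1..n j} \<Longrightarrow> U (Suc (s k)) j i p = (\<Sum>r\<in>{1..R}. P r p * Q r i)"
        by blast
      from polar_factor(1)[OF this i r] show ?thesis .
    qed
    then have "(\<lambda>k. vinner (n j) (dir k j i) (U (Suc (s k)) j r)) \<longlonglongrightarrow> vinner (n j) (dir' j r) (U' j i)"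
      using H_lim[OF r i] by simp
    from LIMSEQ_unique[OF H_lim[OF i r] this] show ?thesis
      by (simp add: mult'_def)
  qed
  show "\<sigma>' i * contract d n X' (\<lambda>l. U' l i) j p = (\<Sum>r\<in>{1..R}. mult' j i r * U' j r p)"
    if i: "i \<in> {1..R}" and p: "p \<in> {1..n j}"
  proof -
    have "dir k j i p = (\<Sum>r\<in>{1..R}. vinner (n j) (dir k j i) (U (Suc (s k)) j r) * U (Suc (s k)) j r p)" for k
    proof -
      from polar[of k] obtain P \<xi> Q where "is_svd (n j) R (dir k j) P \<xi> Q"
        "\<And>i p. i \<in> {1..R} \<Longrightarrow> p \<in> {1..n j} \<Longrightarrow> U (Suc (s k)) j i p = (\<Sum>r\<in>{1..R}. P r p * Q r i)"
        by blast
      from polar_factor(2)[OF this i p] show ?thesis .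
    qed
    moreover have "(\<lambda>k. \<Sum>r\<in>{1..R}. vinner (n j) (dir k j i) (U (Suc (s k)) j r) * U (Suc (s k)) j r p)
        \<longlonglongrightarrow> (\<Sum>r\<in>{1..R}. vinner (n j) (dir' j i) (U' j r) * U' j r p)"
      by (intro tendsto_sum tendsto_mult H_lim U_lim_Suc j' i p)
    ultimately have "(\<lambda>k. dir k j i p) \<longlonglongrightarrow> (\<Sum>r\<in>{1..R}. vinner (n j) (dir' j i) (U' j r) * U' j r p)"
      by simp
    from LIMSEQ_unique[OF dir_limit[OF j' i p] this]
    have eq: "dir' j i p = (\<Sum>r\<in>{1..R}. vinner (n j) (dir' j i) (U' j r) * U' j r p)" .
    have "(\<Sum>r\<in>{1..R}. mult' j i r * U' j r p)
        = dir' j i p - (\<Sum>r\<in>{1..R}. (if i = r then \<alpha> else 0) * U' j r p)"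
      by (simp only: eq mult'_def left_diff_distrib sum_subtractf)
    also have "(\<Sum>r\<in>{1..R}. (if i = r then \<alpha> else 0) * U' j r p) = (\<Sum>r\<in>{1..R}. if i = r then \<alpha> * U' j r p else 0)"
      by (rule sum.cong) auto
    also have "\<dots> = \<alpha> * U' j i p"
      using i by simp
    finally show ?thesis
      by (simp add: dir'_def)
  qed
qed

lemma limit_kkt: "kkt_system d n R t {i\<in>{1..R}. \<sigma>' i \<noteq> 0} \<tau> \<delta> A \<sigma>' U' T' Y' W'"
  unfolding kkt_system_def
proof (intro exI[of _ mult'] conjI ballI)
  show "mult' j i r = mult' j r i" if "j \<in> {d - t + 1..d}" "i \<in> {1..R}" "r \<in> {1..R}" for j i r
    using orthonormal_mode_limit(1)[OF that] .
  show "contract d n X' (\<lambda>l. U' l i) j p = \<sigma>' i * \<tau> * U' j i p"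
    if "j \<in> {1..d - t}" "i \<in> {i\<in>{1..R}. \<sigma>' i \<noteq> 0}" "p \<in> {1..n j}" for j i p
  proof -
    have "\<sigma>' i * contract d n X' (\<lambda>l. U' l i) j p = \<sigma>' i * (\<sigma>' i * \<tau> * U' j i p)"
      using unit_mode_limit[of j i p] that by (simp add: power2_eq_square mult_ac)
    then show ?thesis
      using that(2) by simp
  qed
  show "(\<Sum>p\<in>{1..n j}. U' j i p * U' j i p) = 1" if "j \<in> {1..d - t}" "i \<in> {1..R}" for j i
    using feasible_unit[OF feasible_limit modes_in(1)[OF that(1)] that(2)] by (simp only: vinner_def)
  show "\<sigma>' i * contract d n X' (\<lambda>l. U' l i) j p = (\<Sum>r\<in>{1..R}. mult' j i r * U' j r p)"
    if "j \<in> {d - t + 1..d}" "i \<in> {1..R}" "p \<in> {1..n j}" for j i p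
    using orthonormal_mode_limit(2)[OF that] .
  show "orthonormal_cols (n j) R (U' j)" if "j \<in> {d - t + 1..d}" for j
    using feasible_limit that unfolding feasible_def by blast
  show "(W' I + \<tau>) * T' I = W' I * A I - Y' I + \<tau> * cp d R \<sigma>' U' I" if "I \<in> tidx d n" for I
    using multiplier_limit[OF that] cp_limit[OF that] by (simp add: algebra_simps)
  show "cp d R \<sigma>' U' I = T' I" if "I \<in> tidx d n" for I
    using that by (rule cp_limit)
  show "W' I = \<delta>\<^sup>2 / (\<delta>\<^sup>2 + (T' I - A I)\<^sup>2)" if "I \<in> tidx d n" for I
    using weight_limit[OF that] by (simp only: cauchy_weight_def)
qed

lemma limit_stationary: "stationary_point d n R t \<delta> A \<sigma>' U'"
proof (rule stationary_pointI[where T = T' and Y = Y' and \<tau> = \<tau> and \<Lambda> = mult', OF delta_pos feasible_limit])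
  show "Y' I = cauchy_weight \<delta> (A I - T' I) * (A I - T' I)" if "I \<in> tidx d n" for I
    using multiplier_limit[OF that] weight_limit[OF that] by (simp add: cauchy_weight_def power2_commute)
qed (fact cp_limit coefficient_limit unit_mode_limit orthonormal_mode_limit)+

end

theorem (in hq_admm_run) limit_point_stationary:
  assumes "limit_point d n R \<sigma> U T Y W \<sigma>' U' T' Y' W'"
  shows "kkt_system d n R t {i\<in>{1..R}. \<sigma>' i \<noteq> 0} \<tau> \<delta> A \<sigma>' U' T' Y' W' \<and>
    stationary_point d n R t \<delta> A \<sigma>' U'"
proof -
  from assms obtain s where s: "strict_mono s"
    "(\<lambda>k. vnorm R (\<lambda>i. \<sigma> (s k) i - \<sigma>' i)) \<longlonglongrightarrow> 0"
    "\<forall>j\<in>{1..d}. (\<lambda>k. mnorm (n j) R (\<lambda>i p. U (s k) j i p - U' j i p)) \<longlonglongrightarrow> 0"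
    "(\<lambda>k. tnorm d n (\<lambda>I. T (s k) I - T' I)) \<longlonglongrightarrow> 0"
    "(\<lambda>k. tnorm d n (\<lambda>I. Y (s k) I - Y' I)) \<longlonglongrightarrow> 0"
    "(\<lambda>k. tnorm d n (\<lambda>I. W (s k) I - W' I)) \<longlonglongrightarrow> 0"
    unfolding limit_point_def by blast
  interpret hq_admm_limit d R t n \<alpha> \<tau> \<delta> A \<sigma> U T Y W s \<sigma>' U' T' Y' W'
  proof
    show "strict_mono s"
      by (fact s(1))
    show "(\<lambda>k. \<sigma> (s k) i) \<longlonglongrightarrow> \<sigma>' i" if "i \<in> {1..R}" for i
      using s(2) that unfolding vnorm_def
      by (subst (asm) L2_set_tendsto_zero_iff) (auto intro: LIM_zero_cancel)
    show "(\<lambda>k. U (s k) j i p) \<longlonglongrightarrow> U' j i p" if "j \<in> {1..d}" "i \<in> {1..R}" "p \<in> {1..n j}" for j i p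
      using bspec[OF s(3) that(1)] that(2,3) unfolding mnorm_L2_set
      by (subst (asm) L2_set_tendsto_zero_iff) (auto intro: LIM_zero_cancel)
    show "(\<lambda>k. T (s k) I) \<longlonglongrightarrow> T' I" "(\<lambda>k. Y (s k) I) \<longlonglongrightarrow> Y' I" "(\<lambda>k. W (s k) I) \<longlonglongrightarrow> W' I"
      if "I \<in> tidx d n" for I
      using s(4-6) that unfolding tnorm_L2_set
      by (simp_all add: L2_set_tendsto_zero_iff LIM_zero_iff)
  qed
  show ?thesis
    using limit_kkt limit_stationary ..
qed

section \<open>Convergence of HQ-ADMM\<close>

theorem theorem4p1:
  fixes d R t :: nat and n :: "nat \<Rightarrow> nat" and \<alpha> \<tau> \<delta> :: real and A :: tensor
    and \<sigma> :: "nat \<Rightarrow> rvec" and U :: "nat \<Rightarrow> factors" and T Y W :: "nat \<Rightarrow> tensor"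
  defines "Lt \<equiv> \<lambda>k. aug_lagrangian_prox d n R \<tau> \<delta> A
                       (\<sigma> (Suc k)) (U (Suc k)) (T (Suc k)) (Y (Suc k)) (W (Suc k)) (T k)"
  assumes "1 \<le> R" and "1 \<le> t" and "t \<le> d" and "\<forall>j\<in>{1..d}. 1 \<le> n j"
    and "\<delta> > 0" and "\<alpha> > 0" and "\<tau> \<ge> sqrt 10"
    and "hq_admm d n R t \<alpha> \<tau> \<delta> A \<sigma> U T Y W"
  shows
    \<comment> \<open>boundedness of the iterates\<close>
    "(\<exists>B. \<forall>k. vnorm R (\<sigma> k) \<le> B \<and> (\<forall>j\<in>{1..d}. mnorm (n j) R (U k j) \<le> B) \<and>
              tnorm d n (T k) \<le> B \<and> tnorm d n (Y k) \<le> B \<and> tnorm d n (W k) \<le> B) \<and>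
    \<comment> \<open>monotone from \<open>k = 1\<close> on: for arbitrary \<open>W 0\<close> the value may increase from \<open>Lt 0\<close> to \<open>Lt 1\<close>\<close>
     bounded (range Lt) \<and> decseq (\<lambda>k. Lt (Suc k)) \<and> convergent Lt \<and>
    \<comment> \<open>the sum over \<open>k \<ge> 1\<close>\<close>
     summable (\<lambda>k. let k = Suc k in
        (\<Sum>j\<in>{1..d}. (mnorm (n j) R (\<lambda>i p. U (Suc k) j i p - U k j i p))\<^sup>2)
        + (tnorm d n (\<lambda>I. T (Suc k) I - T k I))\<^sup>2) \<and>
     (\<lambda>k. vnorm R (\<lambda>i. \<sigma> (Suc k) i - \<sigma> k i)) \<longlonglongrightarrow> 0 \<and>
     (\<lambda>k. tnorm d n (\<lambda>I. W (Suc k) I - W k I)) \<longlonglongrightarrow> 0 \<and>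
     (\<lambda>k. tnorm d n (\<lambda>I. cp d R (\<sigma> k) (U k) I - T k I)) \<longlonglongrightarrow> 0 \<and>
     (\<forall>\<sigma>' U' T' Y' W'. limit_point d n R \<sigma> U T Y W \<sigma>' U' T' Y' W' \<longrightarrow>
        kkt_system d n R t {i\<in>{1..R}. \<sigma>' i \<noteq> 0} \<tau> \<delta> A \<sigma>' U' T' Y' W' \<and>
        stationary_point d n R t \<delta> A \<sigma>' U')"
proof -
  interpret hq_admm_run d R t n \<alpha> \<tau> \<delta> A \<sigma> U T Y W
    by unfold_locales (use assms in auto)
  have "bounded (range Lt)"
    using convergent_imp_Bseq[OF Lprox_convergent] unfolding Lt_def Bseq_eq_bounded .
  moreover have "decseq (\<lambda>k. Lt (Suc k))" "convergent Lt"
    using Lprox_decseq Lprox_convergent unfolding Lt_def .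
  moreover have "summable (\<lambda>k. let k = Suc k in
        (\<Sum>j\<in>{1..d}. (mnorm (n j) R (\<lambda>i p. U (Suc k) j i p - U k j i p))\<^sup>2)
        + (tnorm d n (\<lambda>I. T (Suc k) I - T k I))\<^sup>2)"
    using step_T_summable unfolding step_U_def step_T_def Let_def .
  moreover have "(\<lambda>k. tnorm d n (\<lambda>I. W (Suc k) I - W k I)) \<longlonglongrightarrow> 0"
    "(\<lambda>k. tnorm d n (\<lambda>I. cp d R (\<sigma> k) (U k) I - T k I)) \<longlonglongrightarrow> 0"
    unfolding tnorm_L2_set L2_set_tendsto_zero_iff[OF finite_tidx]
    using W_diff_null residual_null by blast+
  ultimately show ?thesis
    using iterates_bounded sigma_step limit_point_stationary by blast
qed

end
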